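(* Suppose that there is a constant $C$ such that for all $\mathbf x=(x_1,x_2)^\top$, $\mathbf p=(p_1,p_2)^\top$, $x_i,p_i\in\mathbb R^{d_i}$, $$-C(|x_2|^2+|p_1|^2)\le\mathbf x^\top Q^{(1)}_{11}\mathbf x+2(x_1,0)^\top Q^{(1)}_{12}\begin{pmatrix}0\\ p_2\end{pmatrix}+2(0,x_2)^\top Q^{(1)}_{12}\begin{pmatrix}p_1\\ 0\end{pmatrix}+\mathbf p^\top Q^{(1)}_{22}\mathbf p\le C(|x_1|^2+|p_2|^2),$$ the same two-sided inequality holds with $Q^{(1)}$ replaced by $Q^{(1)}+Q^{(2)}$, and $$-C|x_2|^2\le\mathbf x^\top Q^{(1)}_T\mathbf x\le C|x_1|^2,\qquad-C|x_2|^2\le\mathbf x^\top\big(Q^{(1)}_T+Q^{(2)}_T\big)\mathbf x\le C|x_1|^2 .$$ Then the HJBI equation $$\partial_tV(t,\mu)+\tfrac12\int_{\mathbb R^d}\mathrm{tr}\big[\sigma^\top\sigma D_x\partial_\mu V(t,\mu,x)\big]\mu(dx)+\mathcal H\big((Id,\partial_\mu V(t,\mu,\cdot))\sharp\mu\big)=0,\quad(t,\mu)\in[0,T)\times\mathcal P_2(\mathbb R^d),\qquad V(T,\mu)=U(\mu),$$ with the quadratic $(\mathcal H,U)$ given in the context, admits a solution $$V(t,\mu)=\int\big[x^\top a^{(1)}(t)x+a^{(2)}(t)^\top x\big]\mu(dx)+\iint x^\top a^{(3)}(t)\hat x\,\mu(d\hat x)\mu(dx)+a^{(4)}(t),\quad(t,\mu)\in[0,T]\times\mathcal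 P_2(\mathbb R^d),$$ where $a^{(1)}(t),a^{(3)}(t)\in\mathbb R^{d\times d}$, $a^{(2)}(t)\in\mathbb R^d$, $a^{(4)}(t)\in\mathbb R$ are deterministic and satisfy on $[0,T]$ (time argument suppressed, $\dot{}=d/dt$) $$\dot a^{(1)}+Q^{(1)}_{11}+4a^{(1)\top}Q^{(1)}_{22}a^{(1)}+2a^{(1)\top}Q^{(1)}_{21}+2Q^{(1)}_{12}a^{(1)}=0,$$ $$\dot a^{(2)}+2Q^{(1)}_{12}a^{(2)}+4a^{(1)}Q^{(1)}_{22}a^{(2)}+4a^{(3)}Q^{(1)}_{22}a^{(2)}+2Q^{(2)}_{12}a^{(2)}+4(a^{(1)}+a^{(3)})Q^{(2)}_{22}a^{(2)}+c_1+2(a^{(1)}+a^{(3)})c_2=0,$$ $$\dot a^{(3)}+2Q^{(1)}_{12}a^{(3)}+2a^{(3)\top}Q^{(1)}_{21}+4a^{(1)\top}Q^{(1)}_{22}a^{(3)}+4a^{(3)\top}Q^{(1)}_{22}a^{(3)}+4a^{(3)\top}Q^{(1)}_{22}a^{(1)}+Q^{(2)}_{11}$$ $$\qquad+2Q^{(2)}_{12}(a^{(1)}+a^{(3)})+2(a^{(1)}+a^{(3)})^\top Q^{(2)}_{21}+4(a^{(1)}+a^{(3)})^\top Q^{(2)}_{22}(a^{(1)}+a^{(3)})=0,$$ $$\dot a^{(4)}+a^{(2)\top}Q^{(1)}_{22}a^{(2)}+a^{(2)\top}Q^{(2)}_{22}a^{(2)}+a^{(2)\top}c_2+\mathrm{tr}[\sigma^\top\sigma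 a^{(1)}]=0,$$ $$a^{(1)}(T)=Q^{(1)}_T,\quad a^{(2)}(T)=\mathbf c_T,\quad a^{(3)}(T)=Q^{(2)}_T,\quad a^{(4)}(T)=0.$$
   Context: $d=d_1+d_2$, $T>0$, $\sigma\in\mathbb R^{d\times d}$ constant. $Q^{(1)},Q^{(2)}\in\mathbb R^{2d\times2d}$ are symmetric with $d\times d$ blocks $Q^{(i)}_{jl}$, $j,l\in\{1,2\}$; $Q^{(1)}_T,Q^{(2)}_T\in\mathbb R^{d\times d}$ symmetric; $\mathbf c=(c_1,c_2)\in\mathbb R^d\times\mathbb R^d$, $\mathbf c_T\in\mathbb R^d$. The data are $$\mathcal H(\tilde\mu)=\int\Big[(x,p)^\top Q^{(1)}\begin{pmatrix}x\\ p\end{pmatrix}+(x,p)^\top\mathbf c\Big]\tilde\mu(dxdp)+(\bar x,\bar p)^\top Q^{(2)}\begin{pmatrix}\bar x\\ \bar p\end{pmatrix},\quad\tilde\mu\in\mathcal P_2(\mathbb R^d\times\mathbb R^d),$$ $$U(\mu)=\int\big[x^\top Q^{(1)}_Tx+x^\top\mathbf c_T\big]\mu(dx)+\bar x^\top Q^{(2)}_T\bar x,\quad\mu\in\mathcal P_2(\mathbb R^d),$$ where $\bar x,\bar p$ are the means. $\mathcal P_2$ is the space of probability measures with finite second moment; $F\sharp\mu$ is the push-forward; the Wasserstein derivative $\partial_\mu V(\mu,x)$ is characterized by $V(\mathrm{Law}(\xi+\eta))-V(\mathrm{Law}(\xi))=\mathbb E[\partial_\mu V(\mathrm{Law}(\xi),\xi)\cdot\eta]+o(\mathbb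 E[|\eta|^2]^{1/2})$. *)

theory Defs
  imports "HOL-Probability.Probability"
begin

text \<open>
  The splitting of the state space into the two players' components is carried by the index
  type: \<open>x = (x1, x2)\<close> is of type \<open>real ^ ('m + 'n)\<close>.  In the same way the block matrices acting
  on \<open>(x, p)\<close> have index type \<open>'i + 'i\<close>.
\<close>

definition stack :: "real ^ 'a \<Rightarrow> real ^ 'b \<Rightarrow> real ^ ('a + 'b)" where
  "stack u v = (\<chi> k. case k of Inl i \<Rightarrow> u $ i | Inr j \<Rightarrow> v $ j)"

definition block11 :: "real ^ ('i + 'i) ^ ('i + 'i) \<Rightarrow> real ^ 'i ^ 'i" where
  "block11 Q = (\<chi> i j. Q $ Inl i $ Inl j)"

definition block12 :: "real ^ ('i + 'i) ^ ('i + 'i) \<Rightarrow> real ^ 'i ^ 'i" where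
  "block12 Q = (\<chi> i j. Q $ Inl i $ Inr j)"

definition block21 :: "real ^ ('i + 'i) ^ ('i + 'i) \<Rightarrow> real ^ 'i ^ 'i" where
  "block21 Q = (\<chi> i j. Q $ Inr i $ Inl j)"

definition block22 :: "real ^ ('i + 'i) ^ ('i + 'i) \<Rightarrow> real ^ 'i ^ 'i" where
  "block22 Q = (\<chi> i j. Q $ Inr i $ Inr j)"

definition quad_form :: "real ^ 'i ^ 'i \<Rightarrow> real ^ 'i \<Rightarrow> real" where
  "quad_form A v = v \<bullet> (A *v v)"

definition running_bound ::
  "real \<Rightarrow> real ^ (('m::finite + 'n::finite) + ('m + 'n)) ^ (('m + 'n) + ('m + 'n)) \<Rightarrow> bool" where
  "running_bound C Q \<longleftrightarrow>
    (\<forall>(x1 :: real ^ 'm) (x2 :: real ^ 'n) (p1 :: real ^ 'm) (p2 :: real ^ 'n).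
      let e = quad_form (block11 Q) (stack x1 x2)
            + 2 * (stack x1 0 \<bullet> (block12 Q *v stack 0 p2))
            + 2 * (stack 0 x2 \<bullet> (block12 Q *v stack p1 0))
            + quad_form (block22 Q) (stack p1 p2)
      in - C * ((norm x2)\<^sup>2 + (norm p1)\<^sup>2) \<le> e \<and> e \<le> C * ((norm x1)\<^sup>2 + (norm p2)\<^sup>2))"

definition terminal_bound :: "real \<Rightarrow> real ^ ('m::finite + 'n::finite) ^ ('m + 'n) \<Rightarrow> bool" where
  "terminal_bound C Q \<longleftrightarrow>
    (\<forall>(x1 :: real ^ 'm) (x2 :: real ^ 'n).
      - C * (norm x2)\<^sup>2 \<le> quad_form Q (stack x1 x2) \<and>
      quad_form Q (stack x1 x2) \<le> C * (norm x1)\<^sup>2)"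


definition P2 :: "'a::euclidean_space measure set" where
  "P2 = {\<mu>. prob_space \<mu> \<and> sets \<mu> = sets borel \<and> integrable \<mu> (\<lambda>x. (norm x)\<^sup>2)}"

definition couplings ::
  "'a::euclidean_space measure \<Rightarrow> 'a measure \<Rightarrow> ('a \<times> 'a) measure set" where
  "couplings \<mu> \<nu> = {\<pi>. prob_space \<pi> \<and> sets \<pi> = sets borel \<and>
                       distr \<pi> borel fst = \<mu> \<and> distr \<pi> borel snd = \<nu>}"

text \<open>
  Only used for \<open>\<mu>, \<nu> \<in> P2\<close>; there the set of couplings is nonempty and the integrand is
  integrable for each of them.
\<close>
definition W2 :: "'a::euclidean_space measure \<Rightarrow> 'a measure \<Rightarrow> real" where
  "W2 \<mu> \<nu> = sqrt (INF \<pi>\<in>couplings \<mu> \<nu>. (\<integral>z. (norm (fst z - snd z))\<^sup>2 \<partial>\<pi>))"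

definition jointly_continuous ::
  "real set \<Rightarrow> (real \<Rightarrow> 'a::euclidean_space measure \<Rightarrow> 'a \<Rightarrow> 'c::metric_space) \<Rightarrow> bool" where
  "jointly_continuous I f \<longleftrightarrow>
    (\<forall>t\<in>I. \<forall>\<mu>\<in>P2. \<forall>x. \<forall>\<epsilon>>0. \<exists>\<delta>>0. \<forall>s\<in>I. \<forall>\<nu>\<in>P2. \<forall>y.
      dist s t < \<delta> \<and> W2 \<nu> \<mu> < \<delta> \<and> dist y x < \<delta> \<longrightarrow> dist (f s \<nu> y) (f t \<mu> x) < \<epsilon>)"

definition square_integrable :: "'w measure \<Rightarrow> ('w \<Rightarrow> 'a::euclidean_space) \<Rightarrow> bool" where
  "square_integrable P X \<longleftrightarrow> X \<in> borel_measurable P \<and> integrable P (\<lambda>\<omega>. (norm (X \<omega>))\<^sup>2)"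

definition L2_norm :: "'w measure \<Rightarrow> ('w \<Rightarrow> 'a::euclidean_space) \<Rightarrow> real" where
  "L2_norm P X = sqrt (\<integral>\<omega>. (norm (X \<omega>))\<^sup>2 \<partial>P)"

text \<open>
  \<open>D\<close> is a version of the Wasserstein derivative of \<open>V\<close> at \<open>\<mu>\<close>.  The sample space type
  \<open>'a \<times> 'a\<close> loses no generality: only the joint law of \<open>(\<xi>, \<eta>)\<close> matters, and every joint law
  on \<open>'a \<times> 'a\<close> is realised there by the coordinate projections.
\<close>
definition has_wasserstein_derivative ::
  "('a::euclidean_space measure \<Rightarrow> real) \<Rightarrow> ('a \<Rightarrow> 'a) \<Rightarrow> 'a measure \<Rightarrow> bool" where
  "has_wasserstein_derivative V D \<mu> \<longleftrightarrow>
    square_integrable \<mu> D \<and>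
    (\<forall>\<epsilon>>0. \<exists>\<delta>>0. \<forall>(P :: ('a \<times> 'a) measure) \<xi> \<eta>.
      prob_space P \<and> square_integrable P \<xi> \<and> square_integrable P \<eta> \<and>
      distr P borel \<xi> = \<mu> \<and> L2_norm P \<eta> < \<delta> \<longrightarrow>
      \<bar>V (distr P borel (\<lambda>\<omega>. \<xi> \<omega> + \<eta> \<omega>)) - V (distr P borel \<xi>) - (\<integral>\<omega>. D (\<xi> \<omega>) \<bullet> \<eta> \<omega> \<partial>P)\<bar>
        \<le> \<epsilon> * L2_norm P \<eta>)"


definition quad_H ::
  "real ^ ('i + 'i) ^ ('i + 'i) \<Rightarrow> real ^ ('i + 'i) ^ ('i + 'i) \<Rightarrow> (real ^ 'i) \<times> (real ^ 'i) \<Rightarrow>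
    ((real ^ 'i) \<times> (real ^ 'i)) measure \<Rightarrow> real" where
  "quad_H Q1 Q2 c \<rho> =
    (\<integral>z. quad_form Q1 (stack (fst z) (snd z)) + z \<bullet> c \<partial>\<rho>)
    + quad_form Q2 (stack (\<integral>z. fst z \<partial>\<rho>) (\<integral>z. snd z \<partial>\<rho>))"

definition quad_U ::
  "real ^ 'i ^ 'i \<Rightarrow> real ^ 'i ^ 'i \<Rightarrow> real ^ 'i \<Rightarrow> (real ^ 'i) measure \<Rightarrow> real" where
  "quad_U QT1 QT2 cT \<mu> =
    (\<integral>x. quad_form QT1 x + x \<bullet> cT \<partial>\<mu>) + quad_form QT2 (\<integral>x. x \<partial>\<mu>)"

text \<open>
  Classical solutions.  The derivative at \<open>\<mu>\<close> is determined only \<open>\<mu>\<close>-almost everywhere by its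
  characterization, so for instance at a Dirac measure the Jacobian in \<open>x\<close> of an arbitrary
  version is arbitrary.  As usual, \<open>DV\<close> is therefore the version that is jointly continuous in
  all its arguments, which is unique.  At \<open>t = 0\<close> the time derivative is one-sided.
\<close>
definition HJBI_solution ::
  "real \<Rightarrow> real ^ 'i ^ 'i \<Rightarrow> (((real ^ 'i) \<times> (real ^ 'i)) measure \<Rightarrow> real) \<Rightarrow>
    ((real ^ 'i) measure \<Rightarrow> real) \<Rightarrow> (real \<Rightarrow> (real ^ 'i) measure \<Rightarrow> real) \<Rightarrow> bool" where
  "HJBI_solution T \<sigma> H U V \<longleftrightarrow>
    jointly_continuous {0..T} (\<lambda>t \<mu> x. V t \<mu>) \<and>
    (\<forall>\<mu>\<in>P2. V T \<mu> = U \<mu>) \<and>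
    (\<exists>(Vt :: real \<Rightarrow> (real ^ 'i) measure \<Rightarrow> real)
       (DV :: real \<Rightarrow> (real ^ 'i) measure \<Rightarrow> real ^ 'i \<Rightarrow> real ^ 'i)
       (DDV :: real \<Rightarrow> (real ^ 'i) measure \<Rightarrow> real ^ 'i \<Rightarrow> real ^ 'i ^ 'i).
      jointly_continuous {0..<T} (\<lambda>t \<mu> x. Vt t \<mu>) \<and>
      jointly_continuous {0..<T} DV \<and>
      jointly_continuous {0..<T} DDV \<and>
      (\<forall>t\<in>{0..<T}. \<forall>\<mu>\<in>P2.
        ((\<lambda>s. V s \<mu>) has_real_derivative Vt t \<mu>) (at t within {0..T}) \<and>
        has_wasserstein_derivative (V t) (DV t \<mu>) \<mu> \<and>
        (\<forall>x. (DV t \<mu> has_derivative (\<lambda>h. DDV t \<mu> x *v h)) (at x)) \<and>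
        integrable \<mu> (\<lambda>x. trace (transpose \<sigma> ** \<sigma> ** DDV t \<mu> x)) \<and>
        Vt t \<mu> + 1 / 2 * (\<integral>x. trace (transpose \<sigma> ** \<sigma> ** DDV t \<mu> x) \<partial>\<mu>)
          + H (distr \<mu> borel (\<lambda>x. (x, DV t \<mu> x))) = 0))"

end

theory Submission imports Defs begin

text \<open>
  For an ansatz that is quadratic in \<open>\<mu>\<close> the HJBI equation reduces to matrix Riccati equations for
  \<open>a1\<close> (data \<open>Q1\<close>) and for \<open>S = a1 + a3\<close> (data \<open>Q1 + Q2\<close>), followed by a linear equation for \<open>a2\<close>
  and an integration for \<open>a4\<close>.  A Riccati solution is \<open>1/2 P X\<^sup>-\<^sup>1\<close>, where \<open>(X, P)\<close> solves the linear
  Hamiltonian system, so only the invertibility of \<open>X\<close> has to be shown; there the saddle point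
  structure of the one-sided bounds enters.
\<close>

subsection \<open>Matrices and linear differential equations\<close>

text \<open>The obstacle is that \<open>block22 Q\<close> may be indefinite, so convexity yields no
  a priori bound against blow-up of the Riccati solution. The running bound gives signs only on two
  subspaces: the form is nonnegative where \<open>x2 = p1 = 0\<close> and nonpositive where
  \<open>x1 = p2 = 0\<close>, in both cases only weakly. Monotonicity along the flow therefore ends
  in equality rather than contradiction, and the equality case has to be analysed separately. The
  parts of \<open>block12 Q\<close> pairing \<open>x1\<close> with \<open>p1\<close> and
  \<open>x2\<close> with \<open>p2\<close> are not restricted by the bounds at all; they cancel in
  the monotone quantity and return only in the equality case, where they multiply \<open>x\<close>
  but not \<open>p\<close>, so that Gronwall absorbs them.

  The reason for working with \<open>S\<close> is that the equation for \<open>a3\<close> alone has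
  coefficients depending on \<open>a1\<close> and carries no sign condition. On a Dirac measure the
  quadratic part of the ansatz is \<open>x \<bullet> (S *v x)\<close>, and adding the equations for
  \<open>a1\<close> and \<open>a3\<close> gives a Riccati equation with data \<open>Q1 + Q2\<close>
  and \<open>QT1 + QT2\<close>. This is where the bounds on the sums are used.\<close>

lemma bounded_bilinear_matrix_matrix_mult:
  "bounded_bilinear (\<lambda>(A :: real ^ 'b ^ 'a) (B :: real ^ 'c ^ 'b). A ** B)"
  unfolding bilinear_conv_bounded_bilinear[symmetric] bilinear_def
  by (auto intro!: linearI simp: matrix_matrix_mult_def vec_eq_iff sum.distrib sum_distrib_left
      algebra_simps)

lemma bounded_bilinear_matrix_vector_mult:
  "bounded_bilinear (\<lambda>(A :: real ^ 'b ^ 'a) (x :: real ^ 'b). A *v x)"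
  unfolding bilinear_conv_bounded_bilinear[symmetric] bilinear_def
  by (auto intro!: linearI simp: matrix_vector_mult_def vec_eq_iff sum.distrib sum_distrib_left
      algebra_simps)

lemma bounded_linear_transpose:
  "bounded_linear (transpose :: real ^ 'b ^ 'a \<Rightarrow> real ^ 'a ^ 'b)"
  unfolding linear_conv_bounded_linear[symmetric]
  by (auto intro!: linearI simp: transpose_def vec_eq_iff)

lemma inner_matrix_vector_mult: "(A *v x) \<bullet> y = x \<bullet> (transpose A *v y)"
  for A :: "real ^ 'n ^ 'm"
  by (metis dot_lmul_matrix inner_commute transpose_matrix_vector transpose_transpose)

lemma symmetric_matrix_inner_commute:
  fixes A :: "real ^ 'n ^ 'n"
  assumes "transpose A = A"
  shows "x \<bullet> (A *v y) = y \<bullet> (A *v x)"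
  using inner_matrix_vector_mult[of A x y] assms by (metis inner_commute)

lemmas matrix_bilinear_simps =
  bounded_bilinear.add_left[OF bounded_bilinear_matrix_matrix_mult]
  bounded_bilinear.add_right[OF bounded_bilinear_matrix_matrix_mult]
  bounded_bilinear.diff_left[OF bounded_bilinear_matrix_matrix_mult]
  bounded_bilinear.diff_right[OF bounded_bilinear_matrix_matrix_mult]
  bounded_bilinear.minus_left[OF bounded_bilinear_matrix_matrix_mult]
  bounded_bilinear.minus_right[OF bounded_bilinear_matrix_matrix_mult]
  bounded_bilinear.scaleR_left[OF bounded_bilinear_matrix_matrix_mult]
  bounded_bilinear.scaleR_right[OF bounded_bilinear_matrix_matrix_mult]

lemmas matrix_vector_bilinear_simps =
  bounded_bilinear.add_left[OF bounded_bilinear_matrix_vector_mult]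
  bounded_bilinear.add_right[OF bounded_bilinear_matrix_vector_mult]
  bounded_bilinear.diff_left[OF bounded_bilinear_matrix_vector_mult]
  bounded_bilinear.diff_right[OF bounded_bilinear_matrix_vector_mult]
  bounded_bilinear.minus_left[OF bounded_bilinear_matrix_vector_mult]
  bounded_bilinear.minus_right[OF bounded_bilinear_matrix_vector_mult]
  bounded_bilinear.scaleR_left[OF bounded_bilinear_matrix_vector_mult]
  bounded_bilinear.scaleR_right[OF bounded_bilinear_matrix_vector_mult]

lemmas transpose_linear_simps =
  linear_add[OF bounded_linear.linear[OF bounded_linear_transpose]]
  linear_diff[OF bounded_linear.linear[OF bounded_linear_transpose]]
  linear_neg[OF bounded_linear.linear[OF bounded_linear_transpose]]
  linear_scale[OF bounded_linear.linear[OF bounded_linear_transpose]]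

text \<open>The solution is the exponential series with terms
  \<open>t ^ n *\<^sub>R (L ^^ n) v / n!\<close>. Since \<open>L\<close> does not depend on time, it
  converges for all times, so no local existence argument or continuation is involved.\<close>

lemma linear_ode_exists:
  fixes L :: "'a::euclidean_space \<Rightarrow> 'a"
  assumes "linear L"
  shows "\<exists>f. f t0 = v \<and> (\<forall>t. (f has_vector_derivative L (f t)) (at t))"
proof -
  have bl: "bounded_linear L" using assms linear_conv_bounded_linear by blast
  then obtain K where K: "K > 0" "\<And>x. norm (L x) \<le> norm x * K"
    using bounded_linear.pos_bounded by blast
  define g where "g n = (L ^^ n) v /\<^sub>R fact n" for n
  have ng: "norm (g n) \<le> norm v * (K ^ n /\<^sub>R fact n)" for n
  proof -
    have "norm ((L ^^ n) v) \<le> norm v * K ^ n"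
    proof (induction n)
      case (Suc n)
      have "norm ((L ^^ Suc n) v) \<le> norm ((L ^^ n) v) * K" using K(2) by simp
      also have "\<dots> \<le> (norm v * K ^ n) * K" using Suc K(1) by (simp add: mult_right_mono)
      finally show ?case by (simp add: mult_ac)
    qed simp
    then show ?thesis by (simp add: g_def divide_simps)
  qed
  have sm: "summable (\<lambda>n. t ^ n *\<^sub>R g n)" for t :: real
  proof (rule summable_comparison_test)
    show "summable (\<lambda>n. norm v * ((\<bar>t\<bar> * K) ^ n /\<^sub>R fact n))"
      by (intro summable_mult summable_exp_generic)
    have "norm (t ^ n *\<^sub>R g n) \<le> norm v * ((\<bar>t\<bar> * K) ^ n /\<^sub>R fact n)" for n
      using mult_left_mono[OF ng, of "\<bar>t\<bar> ^ n" n]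
      by (simp add: power_abs power_mult_distrib mult_ac)
    then show "\<exists>N. \<forall>n\<ge>N. norm (t ^ n *\<^sub>R g n) \<le> norm v * ((\<bar>t\<bar> * K) ^ n /\<^sub>R fact n)"
      by blast
  qed
  define f where "f t = (\<Sum>n. t ^ n *\<^sub>R g n)" for t
  have inner_f: "f t \<bullet> b = (\<Sum>n. (g n \<bullet> b) * t ^ n)" for t b
    unfolding f_def using bounded_linear.suminf[OF bounded_linear_inner_left sm, of t b]
    by (simp add: mult_ac)
  have df: "(f has_vector_derivative L (f t)) (at t)" for t
  proof -
    \<comment> \<open>Paired with a fixed \<open>b\<close> the series becomes a real power series,
      which can be differentiated term by term; the components are reassembled afterwards.\<close>
    have "((\<lambda>t. f t \<bullet> b) has_vector_derivative L (f t) \<bullet> b) (at t)" for b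
    proof -
      have "summable (\<lambda>n. (g n \<bullet> b) * t ^ n)" for t
        using bounded_linear.summable[OF bounded_linear_inner_left sm, of t b] by (simp add: mult_ac)
      then have "((\<lambda>t. \<Sum>n. (g n \<bullet> b) * t ^ n) has_real_derivative
          (\<Sum>n. diffs (\<lambda>n. g n \<bullet> b) n * t ^ n)) (at t)"
        by (rule termdiffs_strong_converges_everywhere)
      moreover have "(\<Sum>n. diffs (\<lambda>n. g n \<bullet> b) n * t ^ n) = L (f t) \<bullet> b"
      proof -
        have "diffs (\<lambda>n. g n \<bullet> b) n = L (g n) \<bullet> b" for n
        proof -
          have "real (Suc n) *\<^sub>R g (Suc n) = L (g n)"
            unfolding g_def by (simp add: linear_scale[OF assms] divide_simps del: of_nat_Suc)
          then show ?thesis unfolding diffs_def by (metis inner_scaleR_left)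
        qed
        moreover have "L (f t) \<bullet> b = (\<Sum>n. t ^ n * (L (g n) \<bullet> b))"
          unfolding f_def
          using bounded_linear.suminf[OF bounded_linear_compose[OF bounded_linear_inner_left bl] sm, of t b]
          by (simp add: linear_scale[OF assms])
        ultimately show ?thesis by (simp add: mult_ac)
      qed
      ultimately show ?thesis
        unfolding inner_f has_real_derivative_iff_has_vector_derivative by simp
    qed
    then show ?thesis
      unfolding has_vector_derivative_def
      by (subst has_derivative_componentwise_within) simp
  qed
  have f0: "f 0 = v" unfolding f_def by (subst suminf_finite[of "{0}"]) (auto simp: g_def)
  \<comment> \<open>The equation is autonomous, so a time shift moves the initial time from 0 to
    \<open>t0\<close>.\<close>
  define h where "h t = f (t - t0)" for t
  have "(h has_vector_derivative L (h t)) (at t)" for t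
  proof -
    have "((\<lambda>t. t - t0) has_vector_derivative 1) (at t)"
      by (auto intro!: derivative_eq_intros)
    from vector_diff_chain_at[OF this df] show ?thesis
      by (simp add: h_def[abs_def] o_def)
  qed
  moreover have "h t0 = v" by (simp add: h_def f0)
  ultimately show ?thesis by blast
qed

section \<open>Differentiating the inverse of a matrix curve\<close>

lemma has_vector_derivative_within_iff:
  "(f has_vector_derivative f') (at t within S) \<longleftrightarrow>
    ((\<lambda>s. (f s - f t) /\<^sub>R (s - t)) \<longlongrightarrow> f') (at t within S)"
proof -
  have "norm (f s - f t - (s - t) *\<^sub>R f') / norm (s - t) = norm ((f s - f t) /\<^sub>R (s - t) - f')"
    if "s \<noteq> t" for s
  proof -
    have "(f s - f t) /\<^sub>R (s - t) - f' = (f s - f t - (s - t) *\<^sub>R f') /\<^sub>R (s - t)"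
      using that by (simp add: scaleR_diff_right)
    then show ?thesis by (simp add: divide_inverse mult.commute)
  qed
  then have "\<forall>\<^sub>F s in at t within S. norm (f s - f t - (s - t) *\<^sub>R f') / norm (s - t)
      = norm ((f s - f t) /\<^sub>R (s - t) - f')"
    by (auto simp: eventually_at_filter)
  then show ?thesis
    unfolding has_vector_derivative_def has_derivative_iff_norm
    by (simp add: bounded_linear_scaleR_left tendsto_cong tendsto_norm_zero_iff LIM_zero_iff)
qed

text \<open>The identity \<open>Y s - Y t = - (Y s ** (X s - X t) ** Y t)\<close> turns difference
  quotients of \<open>Y\<close> into those of \<open>X\<close>. Passing to the limit requires
  continuity of \<open>Y\<close>, which is not assumed and has to be extracted from the same
  identity.\<close>

lemma has_vector_derivative_matrix_inverse:
  fixes X Y :: "real \<Rightarrow> real ^ 'n ^ 'n"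
  assumes X: "(X has_vector_derivative X') (at t within S)" and t: "t \<in> S"
    and YX: "\<And>s. s \<in> S \<Longrightarrow> Y s ** X s = mat 1" and XY: "\<And>s. s \<in> S \<Longrightarrow> X s ** Y s = mat 1"
  shows "(Y has_vector_derivative - (Y t ** X' ** Y t)) (at t within S)"
proof -
  note bb = bounded_bilinear_matrix_matrix_mult[where 'a='n and 'b='n and 'c='n]
  have id: "Y s - Y t = - (Y s ** (X s - X t) ** Y t)" if "s \<in> S" for s
  proof -
    have "Y s ** (X s - X t) ** Y t = Y s ** X s ** Y t - Y s ** (X t ** Y t)"
      by (simp add: matrix_bilinear_simps matrix_mul_assoc)
    then show ?thesis using YX[OF that] XY[OF t] by simp
  qed
  from bounded_bilinear.pos_bounded[OF bb]
  obtain K where K: "K > 0" "\<forall>(A :: real ^ 'n ^ 'n) (B :: real ^ 'n ^ 'n). norm (A ** B) \<le> norm A * norm B * K"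
    by blast
  have cX: "(X \<longlongrightarrow> X t) (at t within S)"
    using has_vector_derivative_continuous[OF X] by (simp add: continuous_within)
  define M where "M = K * K * norm (Y t)"
  have M: "M \<ge> 0" using K by (simp add: M_def)
  have bd: "norm (Y s - Y t) \<le> norm (Y s) * (M * norm (X s - X t))" if "s \<in> S" for s
  proof -
    have "norm (Y s - Y t) \<le> norm (Y s ** (X s - X t)) * norm (Y t) * K"
      unfolding id[OF that] using K by simp
    also have "\<dots> \<le> (norm (Y s) * norm (X s - X t) * K) * norm (Y t) * K"
      using K by (intro mult_right_mono) auto
    finally show ?thesis by (simp add: M_def mult_ac)
  qed
  have sml: "\<forall>\<^sub>F s in at t within S. M * norm (X s - X t) < 1/2"
  proof -
    have "((\<lambda>s. M * norm (X s - X t)) \<longlongrightarrow> M * norm (X t - X t)) (at t within S)"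
      by (intro tendsto_intros cX)
    then show ?thesis by (rule order_tendstoD) simp
  qed
  have inS: "\<forall>\<^sub>F s in at t within S. s \<in> S" by (simp add: eventually_at_filter)
  \<comment> \<open>Near \<open>t\<close> the factor \<open>M * norm (X s - X t)\<close> is below
    1/2. Then \<open>norm (Y s)\<close> is at most \<open>2 * norm (Y t)\<close>, and feeding this
    back into \<open>bd\<close> makes the difference tend to zero.\<close>
  have cY: "(Y \<longlongrightarrow> Y t) (at t within S)"
  proof -
    have ev: "\<forall>\<^sub>F s in at t within S. norm (Y s - Y t) \<le> 2 * norm (Y t) * (M * norm (X s - X t))"
      using sml inS
    proof eventually_elim
      fix s assume s: "M * norm (X s - X t) < 1/2" "s \<in> S"
      then have "norm (Y s - Y t) \<le> norm (Y s) * (M * norm (X s - X t))" using bd by blast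
      moreover have "norm (Y s) * (M * norm (X s - X t)) \<le> norm (Y s) * (1/2)" using s by (intro mult_left_mono) auto
      ultimately have "norm (Y s) \<le> 2 * norm (Y t)" using norm_triangle_sub[of "Y s" "Y t"] by linarith
      then have "norm (Y s) * (M * norm (X s - X t)) \<le> 2 * norm (Y t) * (M * norm (X s - X t))"
        using M by (intro mult_right_mono) auto
      then show "norm (Y s - Y t) \<le> 2 * norm (Y t) * (M * norm (X s - X t))"
        using bd s by (meson order_trans)
    qed
    have lim0: "((\<lambda>s. 2 * norm (Y t) * (M * norm (X s - X t))) \<longlongrightarrow> 2 * norm (Y t) * (M * norm (X t - X t))) (at t within S)"
      by (intro tendsto_intros cX)
    have "((\<lambda>s. Y s - Y t) \<longlongrightarrow> 0) (at t within S)"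
      by (rule Lim_null_comparison[OF ev]) (use lim0 in simp)
    then show ?thesis by (simp add: LIM_zero_cancel)
  qed
  have "((\<lambda>s. (X s - X t) /\<^sub>R (s - t)) \<longlongrightarrow> X') (at t within S)"
    using X by (simp add: has_vector_derivative_within_iff)
  then have "((\<lambda>s. - (Y s ** ((X s - X t) /\<^sub>R (s - t)) ** Y t)) \<longlongrightarrow> - (Y t ** X' ** Y t)) (at t within S)"
    by (intro tendsto_minus bounded_bilinear.tendsto[OF bb] cY tendsto_const)
  moreover have "\<forall>\<^sub>F s in at t within S. - (Y s ** ((X s - X t) /\<^sub>R (s - t)) ** Y t) = (Y s - Y t) /\<^sub>R (s - t)"
    using inS by eventually_elim
      (simp add: id bounded_bilinear.scaleR_left[OF bb] bounded_bilinear.scaleR_right[OF bb])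
  ultimately have "((\<lambda>s. (Y s - Y t) /\<^sub>R (s - t)) \<longlongrightarrow> - (Y t ** X' ** Y t)) (at t within S)"
    by (rule Lim_transform_eventually)
  then show ?thesis by (simp add: has_vector_derivative_within_iff)
qed

subsection \<open>Riccati equations\<close>

definition left_part :: "real ^ ('a::finite + 'b::finite) \<Rightarrow> real ^ 'a" where
  "left_part x = (\<chi> i. x $ Inl i)"

definition right_part :: "real ^ ('a::finite + 'b::finite) \<Rightarrow> real ^ 'b" where
  "right_part x = (\<chi> j. x $ Inr j)"

text \<open>Padded with zeros to the full index type, so that one player's component can be
  multiplied by the same blocks as the whole vector.\<close>

definition proj1 :: "real ^ ('a::finite + 'b::finite) \<Rightarrow> real ^ ('a::finite + 'b::finite)" where
  "proj1 x = stack (left_part x) 0"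

definition proj2 :: "real ^ ('a::finite + 'b::finite) \<Rightarrow> real ^ ('a::finite + 'b::finite)" where
  "proj2 x = stack 0 (right_part x)"

lemma vec_sum_eqI:
  fixes x y :: "'c ^ ('a::finite + 'b::finite)"
  shows "(\<And>i. x $ Inl i = y $ Inl i) \<Longrightarrow> (\<And>j. x $ Inr j = y $ Inr j) \<Longrightarrow> x = y"
  unfolding vec_eq_iff by (metis sumE)

lemma stack_nth [simp]: "stack u v $ Inl i = u $ i" "stack u v $ Inr j = v $ j"
  by (simp_all add: stack_def)

lemma stack_parts [simp]: "stack (left_part x) (right_part x) = x"
  by (rule vec_sum_eqI) (simp_all add: left_part_def right_part_def)

lemma stack_0 [simp]: "stack 0 0 = 0"
  by (rule vec_sum_eqI) simp_all

lemma part_stack [simp]: "left_part (stack u v) = u" "right_part (stack u v) = v"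
  by (simp_all add: left_part_def right_part_def vec_eq_iff)

lemma part_linear [simp]:
  "left_part (x + y) = left_part x + left_part y" "right_part (x + y) = right_part x + right_part y"
  "left_part (r *\<^sub>R x) = r *\<^sub>R left_part x" "right_part (r *\<^sub>R x) = r *\<^sub>R right_part x"
  "left_part 0 = 0" "right_part 0 = 0"
  by (simp_all add: left_part_def right_part_def vec_eq_iff)

lemma proj_linear [simp]:
  "proj1 (x + y) = proj1 x + proj1 y" "proj2 (x + y) = proj2 x + proj2 y"
  "proj1 (r *\<^sub>R x) = r *\<^sub>R proj1 x" "proj2 (r *\<^sub>R x) = r *\<^sub>R proj2 x"
  "proj1 0 = 0" "proj2 0 = 0"
  unfolding proj1_def proj2_def by (auto intro: vec_sum_eqI)

lemma proj_proj [simp]: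
  "proj1 (proj1 x) = proj1 x" "proj2 (proj2 x) = proj2 x" "proj1 (proj2 x) = 0" "proj2 (proj1 x) = 0"
  by (simp_all add: proj1_def proj2_def)

lemma part_proj [simp]: "right_part (proj1 x) = 0" "left_part (proj2 x) = 0"
  by (simp_all add: proj1_def proj2_def)

lemma proj_sum: "proj1 x + proj2 x = x"
  by (rule vec_sum_eqI) (simp_all add: proj1_def proj2_def left_part_def right_part_def)

lemma norm_proj_le: "norm (proj1 x) \<le> norm x" "norm (proj2 x) \<le> norm x"
proof -
  have "norm (proj1 x $ i) \<le> norm (x $ i)" "norm (proj2 x $ i) \<le> norm (x $ i)" for i
    by (cases i; simp add: proj1_def proj2_def left_part_def right_part_def)+
  then show "norm (proj1 x) \<le> norm x" "norm (proj2 x) \<le> norm x"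
    by (auto intro: norm_le_componentwise_cart)
qed

lemma inner_proj [simp]: "proj1 x \<bullet> proj2 y = 0" "proj2 x \<bullet> proj1 y = 0"
proof -
  have "proj1 x $ i * proj2 y $ i = 0" "proj2 x $ i * proj1 y $ i = 0" for i
    by (cases i; simp add: proj1_def proj2_def)+
  then show "proj1 x \<bullet> proj2 y = 0" "proj2 x \<bullet> proj1 y = 0"
    by (auto simp: inner_vec_def intro!: sum.neutral)
qed

lemma inner_proj_diff: "x \<bullet> (proj1 y - proj2 y) = (proj1 x - proj2 x) \<bullet> y"
proof -
  have "(proj1 x + proj2 x) \<bullet> (proj1 y - proj2 y) = (proj1 x - proj2 x) \<bullet> (proj1 y + proj2 y)"
    by (simp add: inner_add_left inner_add_right inner_diff_left inner_diff_right)
  then show ?thesis by (simp only: proj_sum)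
qed

section \<open>The form controlled by the running bound\<close>

lemma symmetric_blocks:
  assumes "transpose Q = Q"
  shows "transpose (block11 Q) = block11 Q" "transpose (block22 Q) = block22 Q"
    "block21 Q = transpose (block12 Q)"
  using assms by (simp_all add: vec_eq_iff transpose_def block11_def block22_def block12_def block21_def)

text \<open>The polarization of the expression in \<open>running_bound\<close>: bilinear in
  \<open>(x, p)\<close> and \<open>(y, q)\<close>, and symmetric when \<open>Q\<close> is. Of the
  coupling block only the pairings of \<open>x1\<close> with \<open>p2\<close> and of
  \<open>x2\<close> with \<open>p1\<close> occur.\<close>

definition game_form where
  "game_form Q x p y q = x \<bullet> (block11 Q *v y)
     + proj1 x \<bullet> (block12 Q *v proj2 q) + proj1 y \<bullet> (block12 Q *v proj2 p)
     + proj2 x \<bullet> (block12 Q *v proj1 q) + proj2 y \<bullet> (block12 Q *v proj1 p)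
     + p \<bullet> (block22 Q *v q)"

lemma running_bound_game_form:
  assumes "running_bound C Q"
  shows "- C * ((norm (right_part x))\<^sup>2 + (norm (left_part p))\<^sup>2) \<le> game_form Q x p x p"
    "game_form Q x p x p \<le> C * ((norm (left_part x))\<^sup>2 + (norm (right_part p))\<^sup>2)"
  using assms[unfolded running_bound_def Let_def, rule_format,
      where ?x1.0="left_part x" and ?x2.0="right_part x" and ?p1.0="left_part p" and ?p2.0="right_part p"]
  by (simp_all add: game_form_def quad_form_def proj1_def proj2_def)

lemma game_form_expand:
  assumes "transpose Q = Q"
  shows "game_form Q (s *\<^sub>R x + y) (s *\<^sub>R p + q) (s *\<^sub>R x + y) (s *\<^sub>R p + q)
    = s * s * game_form Q x p x p + s * (2 * game_form Q x p y q) + game_form Q y q y q"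
  using symmetric_matrix_inner_commute[OF symmetric_blocks(1)[OF assms], of y x]
    symmetric_matrix_inner_commute[OF symmetric_blocks(2)[OF assms], of q p]
  by (simp add: game_form_def matrix_vector_bilinear_simps inner_add_left inner_add_right algebra_simps)

lemma affine_bounded_imp_zero:
  fixes b c d :: real
  assumes "\<And>s. s * b + c \<ge> d"
  shows "b = 0"
proof (rule ccontr)
  assume "b \<noteq> 0"
  then show False using assms[of "(d - c - 1) / b"] by simp
qed

text \<open>
  On the players' isotropic directions the one-sided bounds do not depend on the multiple of the
  isotropic vector, so an isotropic vector lies in the radical of the form.
\<close>
lemma game_form_isotropic:
  assumes "transpose Q = Q" and b: "running_bound C Q"
  shows "game_form Q (proj1 x) (proj2 p) (proj1 x) (proj2 p) = 0 \<Longrightarrow> game_form Q (proj1 x) (proj2 p) y q = 0"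
    "game_form Q (proj2 x) (proj1 p) (proj2 x) (proj1 p) = 0 \<Longrightarrow> game_form Q (proj2 x) (proj1 p) y q = 0"
proof -
  assume 0: "game_form Q (proj1 x) (proj2 p) (proj1 x) (proj2 p) = 0"
  have "2 * game_form Q (proj1 x) (proj2 p) y q = 0"
  proof (rule affine_bounded_imp_zero)
    show "- C * ((norm (right_part y))\<^sup>2 + (norm (left_part q))\<^sup>2)
        \<le> s * (2 * game_form Q (proj1 x) (proj2 p) y q) + game_form Q y q y q" for s
      using running_bound_game_form(1)[OF b, of "s *\<^sub>R proj1 x + y" "s *\<^sub>R proj2 p + q"]
      by (simp add: game_form_expand[OF assms(1)] 0)
  qed
  then show "game_form Q (proj1 x) (proj2 p) y q = 0" by simp
next
  assume 0: "game_form Q (proj2 x) (proj1 p) (proj2 x) (proj1 p) = 0"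
  \<comment> \<open>Here it is the upper bound that does not see the isotropic vector, hence the
    change of sign.\<close>
  have "- (2 * game_form Q (proj2 x) (proj1 p) y q) = 0"
  proof (rule affine_bounded_imp_zero)
    show "- (C * ((norm (left_part y))\<^sup>2 + (norm (right_part q))\<^sup>2))
        \<le> s * (- (2 * game_form Q (proj2 x) (proj1 p) y q)) + - game_form Q y q y q" for s
      using running_bound_game_form(2)[OF b, of "s *\<^sub>R proj2 x + y" "s *\<^sub>R proj1 p + q"]
      by (simp add: game_form_expand[OF assms(1)] 0)
  qed
  then show "game_form Q (proj2 x) (proj1 p) y q = 0" by simp
qed

lemma game_form_add:
  "game_form Q (x + x') (p + p') y q = game_form Q x p y q + game_form Q x' p' y q"
  by (simp add: game_form_def matrix_vector_bilinear_simps inner_add_left inner_add_right)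

text \<open>The left side is half the derivative of \<open>x \<bullet> (proj1 p - proj2 p)\<close>
  along the Hamiltonian flow. By symmetry of \<open>Q\<close> the products of \<open>x1\<close> with
  \<open>x2\<close>, of \<open>p1\<close> with \<open>p2\<close>, of \<open>x1\<close> with
  \<open>p1\<close> and of \<open>x2\<close> with \<open>p2\<close> cancel, and what remains is
  built from the two subspaces on which the form has a sign.\<close>

lemma game_form_proj_diff:
  assumes "transpose Q = Q"
  shows "(block21 Q *v x + block22 Q *v p) \<bullet> (proj1 p - proj2 p)
      - (proj1 x - proj2 x) \<bullet> (block11 Q *v x + block12 Q *v p)
    = game_form Q (proj2 x) (proj1 p) (proj2 x) (proj1 p)
      - game_form Q (proj1 x) (proj2 p) (proj1 x) (proj2 p)"
proof -
  define x1 x2 p1 p2 where "x1 = proj1 x" "x2 = proj2 x" "p1 = proj1 p" "p2 = proj2 p"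
  note sb = symmetric_blocks[OF assms]
  have x: "x = x1 + x2" and p: "p = p1 + p2" by (simp_all add: x1_x2_p1_p2_def proj_sum)
  have sym: "(block22 Q *v u) \<bullet> v = v \<bullet> (block22 Q *v u)" for u v by (rule inner_commute)
  have "(block21 Q *v (x1 + x2) + block22 Q *v (p1 + p2)) \<bullet> (p1 - p2)
      - (x1 - x2) \<bullet> (block11 Q *v (x1 + x2) + block12 Q *v (p1 + p2))
    = (x2 \<bullet> (block11 Q *v x2) + 2 * (x2 \<bullet> (block12 Q *v p1)) + p1 \<bullet> (block22 Q *v p1))
      - (x1 \<bullet> (block11 Q *v x1) + 2 * (x1 \<bullet> (block12 Q *v p2)) + p2 \<bullet> (block22 Q *v p2))"
    using symmetric_matrix_inner_commute[OF sb(1), of x1 x2]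
      symmetric_matrix_inner_commute[OF sb(2), of p1 p2]
    by (simp add: sb(3) dot_lmul_matrix matrix_vector_bilinear_simps inner_add_left inner_add_right
        inner_diff_left inner_diff_right sym algebra_simps)
  then show ?thesis
    unfolding x[symmetric] p[symmetric] by (simp add: game_form_def x1_x2_p1_p2_def)
qed

text \<open>The weight in \<open>\<psi>\<close> turns the linear growth bound into monotonicity:
  \<open>\<psi>\<close> is nonincreasing and vanishes at \<open>a\<close>. The bound is asked only
  on the open interval, since it will come from a derivative known to vanish there.\<close>

lemma gronwall_zero:
  fixes x :: "real \<Rightarrow> 'a::real_inner"
  assumes "a \<le> b" and x0: "x a = 0"
    and x: "\<And>t. (x has_vector_derivative x' t) (at t)"
    and le: "\<And>t. a < t \<Longrightarrow> t < b \<Longrightarrow> norm (x' t) \<le> K * norm (x t)"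
  shows "x b = 0"
proof -
  define \<psi> where "\<psi> t = exp (- 2 * K * t) * (x t \<bullet> x t)" for t
  have d: "(\<psi> has_real_derivative exp (- 2 * K * t) * (2 * (x t \<bullet> x' t) - 2 * K * (x t \<bullet> x t))) (at t)" for t
  proof -
    have "((\<lambda>t. x t \<bullet> x t) has_real_derivative 2 * (x t \<bullet> x' t)) (at t)"
      using bounded_bilinear.has_vector_derivative[OF bounded_bilinear_inner x x, of t]
      by (simp add: has_real_derivative_iff_has_vector_derivative inner_commute)
    then show ?thesis unfolding \<psi>_def
      by (auto intro!: derivative_eq_intros simp: algebra_simps)
  qed
  have "\<psi> a \<ge> \<psi> b"
  proof (rule DERIV_nonpos_imp_decreasing_open[OF \<open>a \<le> b\<close>])
    fix t assume t: "a < t" "t < b"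
    have "x t \<bullet> x' t \<le> norm (x t) * norm (x' t)" by (rule norm_cauchy_schwarz)
    also have "\<dots> \<le> norm (x t) * (K * norm (x t))" using le[OF t] by (simp add: mult_left_mono)
    finally have "2 * (x t \<bullet> x' t) - 2 * K * (x t \<bullet> x t) \<le> 0"
      by (simp add: dot_square_norm power2_eq_square mult_ac)
    then have "exp (- 2 * K * t) * (2 * (x t \<bullet> x' t) - 2 * K * (x t \<bullet> x t)) \<le> 0"
      by (simp only: mult_nonneg_nonpos exp_ge_zero)
    then show "\<exists>y. (\<psi> has_real_derivative y) (at t) \<and> y \<le> 0"
      using d by blast
  next
    show "continuous_on {a..b} \<psi>"
      using d by (meson DERIV_isCont continuous_at_imp_continuous_on)
  qed
  then have "x b \<bullet> x b \<le> 0" by (simp add: \<psi>_def x0 mult_le_0_iff)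
  then show ?thesis using inner_ge_zero[of "x b"] by (metis inner_eq_zero_iff order_antisym)
qed

text \<open>
  The function \<open>x\<^sub>1 \<bullet> p\<^sub>1 - x\<^sub>2 \<bullet> p\<^sub>2\<close> decreases along the Hamiltonian flow, is nonnegative at the
  terminal time and vanishes when \<open>x\<close> does; it is then constant, which forces the trajectory into
  the radical of the form, where \<open>x\<close> satisfies a closed linear equation.
\<close>
lemma hamiltonian_flow_no_return:
  assumes Qs: "transpose Q = Q" and b: "running_bound C Q" and tb: "terminal_bound C QT"
    and QTs: "transpose QT = QT"
    and x: "\<And>t. (x has_vector_derivative 2 *\<^sub>R (block21 Q *v x t + block22 Q *v p t)) (at t)"
    and p: "\<And>t. (p has_vector_derivative - (2 *\<^sub>R (block11 Q *v x t + block12 Q *v p t))) (at t)"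
    and pT: "p T = 2 *\<^sub>R (QT *v x T)" and t0: "t0 \<le> T" "x t0 = 0"
  shows "x T = 0"
proof -
  define g1 where "g1 t = game_form Q (proj1 (x t)) (proj2 (p t)) (proj1 (x t)) (proj2 (p t))" for t
  define g2 where "g2 t = game_form Q (proj2 (x t)) (proj1 (p t)) (proj2 (x t)) (proj1 (p t))" for t
  have g1: "g1 t \<ge> 0" for t
    using running_bound_game_form(1)[OF b, of "proj1 (x t)" "proj2 (p t)"] by (simp add: g1_def)
  have g2: "g2 t \<le> 0" for t
    using running_bound_game_form(2)[OF b, of "proj2 (x t)" "proj1 (p t)"] by (simp add: g2_def)
  \<comment> \<open>Flipping the sign of the second player's component makes the nonnegative
    \<open>g1\<close> and the nonpositive \<open>g2\<close> push \<open>\<phi>\<close> in the same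
    direction.\<close>
  define J where "J v = proj1 v - proj2 v" for v :: "real ^ ('a::finite + 'b::finite)"
  have J: "bounded_linear J"
    unfolding J_def linear_conv_bounded_linear[symmetric]
    by (rule linearI) (simp_all add: algebra_simps)
  define \<phi> where "\<phi> t = x t \<bullet> J (p t)" for t
  have d\<phi>: "(\<phi> has_real_derivative 2 * (g2 t - g1 t)) (at t)" for t
  proof -
    have "(\<phi> has_real_derivative x t \<bullet> J (- (2 *\<^sub>R (block11 Q *v x t + block12 Q *v p t)))
        + 2 *\<^sub>R (block21 Q *v x t + block22 Q *v p t) \<bullet> J (p t)) (at t)"
      unfolding has_real_derivative_iff_has_vector_derivative \<phi>_def
      by (rule bounded_bilinear.has_vector_derivative[OF bounded_bilinear_inner x
            bounded_linear.has_vector_derivative[OF J p]])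
    moreover have "x t \<bullet> J (- (2 *\<^sub>R (block11 Q *v x t + block12 Q *v p t)))
        = - 2 * ((proj1 (x t) - proj2 (x t)) \<bullet> (block11 Q *v x t + block12 Q *v p t))"
      unfolding J_def inner_proj_diff by simp
    moreover have "(2 *\<^sub>R (block21 Q *v x t + block22 Q *v p t)) \<bullet> J (p t)
        = 2 * ((block21 Q *v x t + block22 Q *v p t) \<bullet> (proj1 (p t) - proj2 (p t)))"
      by (simp add: J_def)
    ultimately have "(\<phi> has_real_derivative
        2 * ((block21 Q *v x t + block22 Q *v p t) \<bullet> (proj1 (p t) - proj2 (p t))
          - (proj1 (x t) - proj2 (x t)) \<bullet> (block11 Q *v x t + block12 Q *v p t))) (at t)"
      by (simp only: right_diff_distrib) (simp only: mult_minus_left add.commute diff_conv_add_uminus)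
    then show ?thesis
      unfolding game_form_proj_diff[OF Qs] g1_def g2_def .
  qed
  have cont: "continuous_on S \<phi>" for S
    using d\<phi> by (meson DERIV_isCont continuous_at_imp_continuous_on)
  have mono: "\<phi> s \<ge> \<phi> t" if "s \<le> t" for s t
    using that
  proof (rule DERIV_nonpos_imp_decreasing_open)
    show "\<exists>y. (\<phi> has_real_derivative y) (at r) \<and> y \<le> 0" for r
    proof -
      have "2 * (g2 r - g1 r) \<le> 0" using g1[of r] g2[of r] by simp
      then show ?thesis using d\<phi> by blast
    qed
  qed (rule cont)
  have "\<phi> T \<ge> 0"
  proof -
    define y1 y2 where "y1 = proj1 (x T)" "y2 = proj2 (x T)"
    have "x T \<bullet> J (QT *v x T) = (y1 - y2) \<bullet> (QT *v (y1 + y2))"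
      unfolding J_def inner_proj_diff y1_y2_def proj_sum by simp
    also have "\<dots> = y1 \<bullet> (QT *v y1) - y2 \<bullet> (QT *v y2)"
      using symmetric_matrix_inner_commute[OF QTs, of y1 y2]
      by (simp add: inner_diff_left inner_add_right matrix_vector_bilinear_simps)
    \<comment> \<open>With one component set to zero, one side of \<open>terminal_bound\<close>
      becomes zero: \<open>QT\<close> is nonnegative on \<open>y1\<close> and nonpositive on
      \<open>y2\<close>.\<close>
    also have "\<dots> \<ge> 0"
      using tb[unfolded terminal_bound_def, rule_format, where ?x1.0="left_part (x T)" and ?x2.0=0]
        tb[unfolded terminal_bound_def, rule_format, where ?x1.0=0 and ?x2.0="right_part (x T)"]
      by (simp add: quad_form_def y1_y2_def proj1_def proj2_def)
    finally show ?thesis by (simp add: \<phi>_def pT bounded_linear.linear[OF J, THEN linear_scale])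
  qed
  moreover have "\<phi> t0 = 0" by (simp add: \<phi>_def t0)
  ultimately have \<phi>0: "\<phi> t = 0" if "t0 \<le> t" "t \<le> T" for t
    using mono[of t0 t] mono[of t T] that by linarith
  have g0: "g1 t = 0" "g2 t = 0" if t: "t0 < t" "t < T" for t
  proof -
    \<comment> \<open>On the open interval \<open>\<phi>\<close> agrees with zero, so its derivative
      vanishes; since \<open>g2 t \<le> 0 \<le> g1 t\<close>, both terms vanish separately.\<close>
    have "((\<lambda>t. 0) has_real_derivative 2 * (g2 t - g1 t)) (at t)"
      by (rule has_field_derivative_transform_within_open[OF d\<phi>, where S="{t0<..<T}"]) (use t \<phi>0 in auto)
    then have "2 * (g2 t - g1 t) = 0" by (rule DERIV_unique) simp
    then show "g1 t = 0" "g2 t = 0" using g1[of t] g2[of t] by simp_all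
  qed
  obtain K where K: "K > 0" "\<And>v. norm (block12 Q *v v) \<le> norm v * K"
    using bounded_linear.pos_bounded[OF matrix_vector_mul_bounded_linear] by blast
  show ?thesis
  proof (rule gronwall_zero[OF t0 x])
    fix t assume t: "t0 < t" "t < T"
    let ?q = "2 *\<^sub>R (block21 Q *v x t + block22 Q *v p t)"
    \<comment> \<open>The two isotropic vectors add up to \<open>(x t, p t)\<close>, which therefore
      lies in the radical. It is tested against \<open>(0, ?q)\<close>, where \<open>?q\<close> is
      the velocity of \<open>x\<close>.\<close>
    have "game_form Q (x t) (p t) 0 ?q = 0"
    proof -
      have "game_form Q (proj1 (x t) + proj2 (x t)) (proj2 (p t) + proj1 (p t)) 0 ?q = 0"
        unfolding game_form_add
        using game_form_isotropic[OF Qs b] g0[OF t] by (simp add: g1_def g2_def)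
      then show ?thesis by (metis add.commute proj_sum)
    qed
    then have rad: "proj1 (x t) \<bullet> (block12 Q *v proj2 ?q) + proj2 (x t) \<bullet> (block12 Q *v proj1 ?q)
        + p t \<bullet> (block22 Q *v ?q) = 0"
      by (simp only: game_form_def matrix_vector_mult_0_right inner_zero_right inner_zero_left proj_linear)
    \<comment> \<open>Subtracting the radical identity removes every term with \<open>p\<close>. The
      survivors pair \<open>x\<close> with \<open>?q\<close> through exactly those parts of
      \<open>block12 Q\<close> that \<open>game_form\<close> omits, so the velocity is bounded by
      \<open>x\<close> alone.\<close>
    have "?q \<bullet> ?q = 2 * (x t \<bullet> (block12 Q *v ?q) + p t \<bullet> (block22 Q *v ?q))"
    proof -
      have "(block21 Q *v x t) \<bullet> v = x t \<bullet> (block12 Q *v v)" for v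
        by (simp add: symmetric_blocks[OF Qs] dot_lmul_matrix)
      moreover have "(block22 Q *v p t) \<bullet> v = p t \<bullet> (block22 Q *v v)" for v
        by (metis inner_commute symmetric_matrix_inner_commute symmetric_blocks(2)[OF Qs])
      ultimately show ?thesis by (simp only: inner_scaleR_left inner_add_left)
    qed
    also have "x t \<bullet> (block12 Q *v ?q)
        = (proj1 (x t) + proj2 (x t)) \<bullet> (block12 Q *v (proj1 ?q + proj2 ?q))"
      by (simp only: proj_sum)
    also have "2 * (\<dots> + p t \<bullet> (block22 Q *v ?q))
        = 2 * (proj1 (x t) \<bullet> (block12 Q *v proj1 ?q) + proj2 (x t) \<bullet> (block12 Q *v proj2 ?q))"
      using rad by (simp only: inner_add_left inner_add_right matrix_vector_right_distrib) argo
    also have "\<dots> \<le> 2 * (norm (x t) * (norm ?q * K) + norm (x t) * (norm ?q * K))"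
    proof -
      have "u \<bullet> (block12 Q *v w) \<le> norm (x t) * (norm ?q * K)" if "norm u \<le> norm (x t)" "norm w \<le> norm ?q" for u w
      proof -
        have "u \<bullet> (block12 Q *v w) \<le> norm u * norm (block12 Q *v w)" by (rule norm_cauchy_schwarz)
        also have "\<dots> \<le> norm (x t) * (norm ?q * K)"
          using that(2) by (intro mult_mono that(1) order_trans[OF K(2)] mult_right_mono) (use K(1) in auto)
        finally show ?thesis .
      qed
      then show ?thesis by (intro mult_left_mono add_mono) (auto simp only: norm_proj_le zero_le_numeral)
    qed
    finally have "norm ?q * norm ?q \<le> norm ?q * (4 * K * norm (x t))"
      by (simp add: dot_square_norm power2_eq_square algebra_simps)
    moreover have "0 \<le> 4 * K * norm (x t)" using K(1) by simp
    \<comment> \<open>Cancels one factor \<open>norm ?q\<close>, including the case where it is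
      zero.\<close>
    moreover have "a \<le> c" if "a * a \<le> a * c" "0 \<le> c" for a c :: real
      using that by (cases "a > 0") (auto simp: mult_le_cancel_left)
    ultimately show "norm ?q \<le> (4 * K) * norm (x t)" by blast
  qed
qed

text \<open>Kept general in \<open>Q\<close> and \<open>QT\<close> because it is applied to the data
  of \<open>a1\<close> and again to the summed data of \<open>S\<close>. Symmetry belongs to the
  conclusion: it allows the equation to be written without transposes, and it is what the
  Wasserstein derivative of the ansatz relies on.\<close>

lemma riccati_exists:
  fixes QT :: "real ^ ('m::finite + 'n::finite) ^ ('m + 'n)"
  assumes Qs: "transpose Q = Q" and b: "running_bound C Q" and tb: "terminal_bound C QT"
    and QTs: "transpose QT = QT"
  shows "\<exists>A. A T = QT \<and> (\<forall>t\<in>{a..T}. transpose (A t) = A t \<and>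
    (A has_vector_derivative - (block11 Q + 4 *\<^sub>R (A t ** block22 Q ** A t)
       + 2 *\<^sub>R (A t ** block21 Q) + 2 *\<^sub>R (block12 Q ** A t))) (at t within {a..T}))"
proof -
  define L where "L = (\<lambda>Z :: (real ^ ('m + 'n) ^ ('m + 'n)) \<times> (real ^ ('m + 'n) ^ ('m + 'n)).
    (2 *\<^sub>R (block21 Q ** fst Z + block22 Q ** snd Z), - (2 *\<^sub>R (block11 Q ** fst Z + block12 Q ** snd Z))))"
  have "linear L" unfolding L_def
    by (rule linearI) (simp_all add: matrix_bilinear_simps algebra_simps)
  \<comment> \<open>These terminal data give \<open>A T = QT\<close>, and for every \<open>v\<close>
    the trajectory \<open>(X t *v v, P t *v v)\<close> satisfies the terminal relation
    \<open>p = 2 QT x\<close>.\<close>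
  from linear_ode_exists[OF this, of T "(mat 1, 2 *\<^sub>R QT)"] obtain Z
    where ZT: "Z T = (mat 1, 2 *\<^sub>R QT)" and Z: "\<And>t. (Z has_vector_derivative L (Z t)) (at t)" by blast
  define X P where "X = fst \<circ> Z" "P = snd \<circ> Z"
  have X: "(X has_vector_derivative 2 *\<^sub>R (block21 Q ** X t + block22 Q ** P t)) (at t)" for t
    using bounded_linear.has_vector_derivative[OF bounded_linear_fst Z, of t]
    by (simp add: X_P_def L_def o_def)
  have P: "(P has_vector_derivative - (2 *\<^sub>R (block11 Q ** X t + block12 Q ** P t))) (at t)" for t
    using bounded_linear.has_vector_derivative[OF bounded_linear_snd Z, of t]
    by (simp add: X_P_def L_def o_def)
  have XT: "X T = mat 1" and PT: "P T = 2 *\<^sub>R QT" by (simp_all add: X_P_def ZT)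
  \<comment> \<open>A kernel vector \<open>v\<close> of \<open>X t\<close> yields a trajectory whose
    state vanishes at time \<open>t\<close>, hence also at \<open>T\<close>, where the state is
    \<open>v\<close> itself.\<close>
  have inj: "v = 0" if "t \<le> T" "X t *v v = 0" for t v
  proof -
    note bl = bounded_bilinear.bounded_linear_left[OF bounded_bilinear_matrix_vector_mult, of v]
    have "X T *v v = 0"
    proof (rule hamiltonian_flow_no_return[OF Qs b tb QTs, where p="\<lambda>t. P t *v v" and ?t0.0=t])
      show "((\<lambda>t. X t *v v) has_vector_derivative
          2 *\<^sub>R (block21 Q *v (X s *v v) + block22 Q *v (P s *v v))) (at s)" for s
        using bounded_linear.has_vector_derivative[OF bl X, of s]
        by (simp only: matrix_vector_bilinear_simps matrix_vector_mul_assoc)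
      show "((\<lambda>t. P t *v v) has_vector_derivative
          - (2 *\<^sub>R (block11 Q *v (X s *v v) + block12 Q *v (P s *v v)))) (at s)" for s
        using bounded_linear.has_vector_derivative[OF bl P, of s]
        by (simp only: matrix_vector_bilinear_simps matrix_vector_mul_assoc)
    qed (use that in \<open>simp_all add: XT PT matrix_vector_bilinear_simps\<close>)
    then show ?thesis by (simp add: XT)
  qed
  then have "\<forall>t. \<exists>B. t \<le> T \<longrightarrow> B ** X t = mat 1"
    by (metis matrix_left_invertible_ker)
  then obtain Y where YX: "\<And>t. t \<le> T \<Longrightarrow> Y t ** X t = mat 1" by metis
  then have XY: "X t ** Y t = mat 1" if "t \<le> T" for t
    using matrix_left_right_inverse that by blast
  \<comment> \<open>The flow is Hamiltonian, so this symplectic pairing of the columns is conserved;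
    it vanishes at \<open>T\<close> because \<open>QT\<close> is symmetric.\<close>
  have sym: "transpose (X t) ** P t = transpose (P t) ** X t" for t
  proof -
    note sb = symmetric_blocks[OF Qs]
    define W where "W t = transpose (X t) ** P t - transpose (P t) ** X t" for t
    have "(W has_vector_derivative 0) (at t)" for t
    proof -
      note dmul = bounded_bilinear.has_vector_derivative[OF bounded_bilinear_matrix_matrix_mult]
      note dtr = bounded_linear.has_vector_derivative[OF bounded_linear_transpose]
      show ?thesis unfolding W_def
        by (rule has_vector_derivative_eq_rhs,
            rule has_vector_derivative_diff[OF dmul[OF dtr[OF X] P] dmul[OF dtr[OF P] X]])
          (simp add: matrix_bilinear_simps transpose_linear_simps matrix_transpose_mul sb
            matrix_mul_assoc algebra_simps)
    qed
    then have "W t = W T"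
      using has_vector_derivative_zero_constant[of UNIV W] by (metis convex_UNIV iso_tuple_UNIV_I)
    then show ?thesis
      by (simp add: W_def XT PT transpose_linear_simps QTs)
  qed
  define A where "A t = (1 / 2) *\<^sub>R (P t ** Y t)" for t
  show ?thesis
  proof (intro exI[of _ A] conjI ballI)
    show "A T = QT"
      using YX[of T] by (simp add: A_def XT PT matrix_bilinear_simps)
    fix t assume t: "t \<in> {a..T}"
    have PA: "P t = 2 *\<^sub>R (A t ** X t)"
      using YX[of t] t by (simp add: A_def matrix_bilinear_simps matrix_mul_assoc[symmetric])
    show "transpose (A t) = A t"
    proof -
      \<comment> \<open>Multiplying the conserved relation by the inverse on both sides turns it
        into symmetry of \<open>P t ** Y t\<close>.\<close>
      have "transpose (Y t) ** (transpose (X t) ** P t) ** Y t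
          = transpose (Y t) ** (transpose (P t) ** X t) ** Y t" by (simp only: sym)
      moreover have "transpose (Y t) ** (transpose (X t) ** P t) = P t"
        using XY[of t] t by (metis (no_types, lifting) atLeastAtMost_iff matrix_mul_assoc matrix_mul_lid transpose_mat matrix_transpose_mul)
      moreover have "transpose (Y t) ** (transpose (P t) ** X t) ** Y t = transpose (Y t) ** transpose (P t)"
        using XY[of t] t by (metis (no_types, lifting) atLeastAtMost_iff matrix_mul_assoc matrix_mul_rid)
      ultimately show ?thesis
        by (simp add: A_def transpose_linear_simps matrix_transpose_mul)
    qed
    have dY: "(Y has_vector_derivative
        - (Y t ** (2 *\<^sub>R (block21 Q ** X t + block22 Q ** P t)) ** Y t)) (at t within {a..T})"
      using t YX XY
      by (intro has_vector_derivative_matrix_inverse[OF has_vector_derivative_at_within[OF X]]) auto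
    have "(A has_vector_derivative (1 / 2) *\<^sub>R
        (P t ** - (Y t ** (2 *\<^sub>R (block21 Q ** X t + block22 Q ** P t)) ** Y t)
         + - (2 *\<^sub>R (block11 Q ** X t + block12 Q ** P t)) ** Y t)) (at t within {a..T})"
      unfolding A_def
      by (intro bounded_linear.has_vector_derivative[OF bounded_linear_scaleR_right]
          bounded_bilinear.has_vector_derivative[OF bounded_bilinear_matrix_matrix_mult _ dY]
          has_vector_derivative_at_within[OF P])
    moreover have PY: "P t ** Y t = 2 *\<^sub>R A t" by (simp add: A_def)
    \<comment> \<open>These cancellations eliminate \<open>X\<close> and \<open>P\<close>. Each
      occurrence of \<open>P t ** Y t\<close> contributes \<open>2 *\<^sub>R A t\<close>, which
      produces the coefficient 4 of the quadratic term.\<close>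
    moreover have "B ** X t ** Y t = B" "B ** P t ** Y t = 2 *\<^sub>R (B ** A t)" for B :: "real ^ ('m + 'n) ^ ('m + 'n)"
      using XY[of t] t PY by (simp_all add: matrix_mul_assoc[symmetric] matrix_bilinear_simps)
    ultimately show "(A has_vector_derivative - (block11 Q + 4 *\<^sub>R (A t ** block22 Q ** A t)
       + 2 *\<^sub>R (A t ** block21 Q) + 2 *\<^sub>R (block12 Q ** A t))) (at t within {a..T})"
      by (simp add: matrix_bilinear_simps matrix_mul_assoc algebra_simps)
  qed
qed

subsection \<open>Moments and the Wasserstein distance\<close>

text \<open>The rank-one matrix of \<open>x\<close> and \<open>y\<close>. Through
  \<open>inner_outer\<close> a quadratic form becomes linear in \<open>outer x x\<close>, so its
  integral is the inner product of its matrix with the second moment matrix.\<close>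

definition outer :: "real ^ 'i \<Rightarrow> real ^ 'i \<Rightarrow> real ^ 'i ^ 'i" where
  "outer x y = (\<chi> i. x $ i *\<^sub>R y)"

lemma bounded_bilinear_outer: "bounded_bilinear outer"
  unfolding bilinear_conv_bounded_bilinear[symmetric] bilinear_def
  by (auto intro!: linearI simp: outer_def vec_eq_iff algebra_simps)

lemmas outer_simps =
  bounded_bilinear.add_left[OF bounded_bilinear_outer]
  bounded_bilinear.add_right[OF bounded_bilinear_outer]
  bounded_bilinear.diff_left[OF bounded_bilinear_outer]
  bounded_bilinear.diff_right[OF bounded_bilinear_outer]

lemma norm_outer: "norm (outer x y) = norm x * norm y"
proof -
  have "norm (outer x y) = L2_set (\<lambda>i. norm (x $ i) * norm y) UNIV"
    unfolding norm_vec_def[of "outer x y"] by (simp add: outer_def)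
  also have "\<dots> = L2_set (\<lambda>i. norm (x $ i)) UNIV * norm y"
    by (rule L2_set_left_distrib[symmetric]) simp
  finally show ?thesis by (simp add: norm_vec_def[of x])
qed

lemma inner_outer: "A \<bullet> outer x y = x \<bullet> (A *v y)"
proof -
  have "A \<bullet> outer x y = (\<Sum>i\<in>UNIV. A $ i \<bullet> (x $ i *\<^sub>R y))"
    by (simp add: inner_vec_def[of A] outer_def)
  also have "\<dots> = x \<bullet> (A *v y)"
    unfolding inner_vec_def[of x] by (simp add: matrix_vector_mul_component)
  finally show ?thesis .
qed

lemma outer_measurable [measurable]:
  assumes "X \<in> borel_measurable P" "Y \<in> borel_measurable P"
  shows "(\<lambda>\<omega>. outer (X \<omega>) (Y \<omega>)) \<in> borel_measurable P"
  by (rule borel_measurable_continuous_Pair[OF assms])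
    (intro bounded_bilinear.continuous_on[OF bounded_bilinear_outer] continuous_intros)

section \<open>Square integrable random vectors\<close>

lemma square_integrableD:
  assumes "square_integrable P X"
  shows "X \<in> borel_measurable P" "integrable P (\<lambda>\<omega>. (norm (X \<omega>))\<^sup>2)"
  using assms by (auto simp: square_integrable_def)

lemma norm_mult_le_sum_squares: "norm x * norm y \<le> (norm x)\<^sup>2 + (norm y)\<^sup>2"
proof -
  have "0 \<le> (norm x - norm y)\<^sup>2" by simp
  moreover have "0 \<le> norm x * norm y" by simp
  ultimately show ?thesis unfolding power2_diff by linarith
qed

lemma integrable_outer:
  assumes "square_integrable P X" "square_integrable P Y"
  shows "integrable P (\<lambda>\<omega>. outer (X \<omega>) (Y \<omega>))"
proof (rule Bochner_Integration.integrable_bound)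
  show "integrable P (\<lambda>\<omega>. (norm (X \<omega>))\<^sup>2 + (norm (Y \<omega>))\<^sup>2)"
    using assms by (simp add: square_integrableD)
  show "AE \<omega> in P. norm (outer (X \<omega>) (Y \<omega>)) \<le> norm ((norm (X \<omega>))\<^sup>2 + (norm (Y \<omega>))\<^sup>2)"
    by (simp add: norm_outer norm_mult_le_sum_squares)
qed (use assms in \<open>simp add: square_integrableD outer_measurable\<close>)

lemma square_integrable_integrable:
  assumes "prob_space P" "square_integrable P X"
  shows "integrable P X"
proof (rule Bochner_Integration.integrable_bound)
  interpret prob_space P by fact
  show "integrable P (\<lambda>\<omega>. 1 + (norm (X \<omega>))\<^sup>2)"
    using assms by (simp add: square_integrableD)
  have "norm (X \<omega>) \<le> 1 + (norm (X \<omega>))\<^sup>2" for \<omega>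
    using norm_mult_le_sum_squares[of "1::real" "X \<omega>"] by simp
  then show "AE \<omega> in P. norm (X \<omega>) \<le> norm (1 + (norm (X \<omega>))\<^sup>2)"
    by simp
qed (use assms in \<open>simp add: square_integrableD\<close>)

lemma square_integrable_add:
  assumes "square_integrable P X" "square_integrable P Y"
  shows "square_integrable P (\<lambda>\<omega>. X \<omega> + Y \<omega>)"
  unfolding square_integrable_def
proof
  have [measurable]: "X \<in> borel_measurable P" "Y \<in> borel_measurable P"
    using assms by (simp_all add: square_integrableD)
  show "(\<lambda>\<omega>. X \<omega> + Y \<omega>) \<in> borel_measurable P" by measurable
  show "integrable P (\<lambda>\<omega>. (norm (X \<omega> + Y \<omega>))\<^sup>2)"
  proof (rule Bochner_Integration.integrable_bound)
    show "integrable P (\<lambda>\<omega>. 2 * (norm (X \<omega>))\<^sup>2 + 2 * (norm (Y \<omega>))\<^sup>2)"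
      using assms by (simp add: square_integrableD)
    have "(norm (x + y))\<^sup>2 \<le> 2 * (norm x)\<^sup>2 + 2 * (norm y)\<^sup>2" for x y :: 'b
    proof -
      have "(norm (x + y))\<^sup>2 \<le> (norm x + norm y)\<^sup>2" by (simp add: power_mono norm_triangle_ineq)
      moreover have "0 \<le> (norm x - norm y)\<^sup>2" by simp
      ultimately show ?thesis unfolding power2_diff power2_sum by linarith
    qed
    then show "AE \<omega> in P. norm ((norm (X \<omega> + Y \<omega>))\<^sup>2) \<le> norm (2 * (norm (X \<omega>))\<^sup>2 + 2 * (norm (Y \<omega>))\<^sup>2)"
      by simp
  qed simp
qed

text \<open>Jensen's inequality for the squared norm, obtained by integrating the elementary bound
  on \<open>?h \<bullet> X \<omega>\<close> with \<open>?h\<close> the expectation itself.\<close>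

lemma norm_expectation_sq_le:
  assumes "prob_space P" "square_integrable P X"
  shows "(norm (\<integral>\<omega>. X \<omega> \<partial>P))\<^sup>2 \<le> (\<integral>\<omega>. (norm (X \<omega>))\<^sup>2 \<partial>P)"
proof -
  interpret prob_space P by fact
  let ?h = "\<integral>\<omega>. X \<omega> \<partial>P"
  note int = square_integrable_integrable[OF assms]
  have "?h \<bullet> ?h = (\<integral>\<omega>. ?h \<bullet> X \<omega> \<partial>P)" using int by simp
  also have "\<dots> \<le> (\<integral>\<omega>. ((norm ?h)\<^sup>2 + (norm (X \<omega>))\<^sup>2) / 2 \<partial>P)"
  proof (rule integral_mono)
    fix \<omega>
    have "0 \<le> (norm (?h - X \<omega>))\<^sup>2" by simp
    then show "?h \<bullet> X \<omega> \<le> ((norm ?h)\<^sup>2 + (norm (X \<omega>))\<^sup>2) / 2"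
      by (simp add: power2_norm_eq_inner inner_diff_left inner_diff_right inner_commute)
  qed (use int square_integrableD(2)[OF assms(2)] in simp_all)
  also have "\<dots> = ((norm ?h)\<^sup>2 + (\<integral>\<omega>. (norm (X \<omega>))\<^sup>2 \<partial>P)) / 2"
    using square_integrableD(2)[OF assms(2)] by (simp add: prob_space)
  finally show ?thesis by (simp add: power2_norm_eq_inner)
qed

section \<open>Mean and second moment matrix\<close>

definition mean :: "(real ^ 'i) measure \<Rightarrow> real ^ 'i" where
  "mean \<mu> = (\<integral>x. x \<partial>\<mu>)"

definition second_moment :: "(real ^ 'i) measure \<Rightarrow> real ^ 'i ^ 'i" where
  "second_moment \<mu> = (\<integral>x. outer x x \<partial>\<mu>)"

lemma P2_iff: "\<mu> \<in> P2 \<longleftrightarrow> prob_space \<mu> \<and> sets \<mu> = sets borel \<and> square_integrable \<mu> (\<lambda>x. x)"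
  by (auto simp: P2_def square_integrable_def measurable_ident_sets)

lemma P2_prob_space: "\<mu> \<in> P2 \<Longrightarrow> prob_space \<mu>"
  by (simp add: P2_def)

lemma P2_square_integrable: "\<mu> \<in> P2 \<Longrightarrow> square_integrable \<mu> (\<lambda>x. x)"
  by (simp add: P2_iff)

lemma P2_integrable:
  assumes "\<mu> \<in> P2"
  shows "integrable \<mu> (\<lambda>x. x)" "integrable \<mu> (\<lambda>x. outer x x)"
  using assms by (simp_all add: P2_iff square_integrable_integrable integrable_outer)

lemma moments_distr:
  assumes "square_integrable P X"
  shows "mean (distr P borel X) = (\<integral>\<omega>. X \<omega> \<partial>P)"
    "second_moment (distr P borel X) = (\<integral>\<omega>. outer (X \<omega>) (X \<omega>) \<partial>P)"
proof -
  have [measurable]: "X \<in> borel_measurable P" using assms by (simp add: square_integrableD)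
  show "mean (distr P borel X) = (\<integral>\<omega>. X \<omega> \<partial>P)" unfolding mean_def by (subst integral_distr) auto
  show "second_moment (distr P borel X) = (\<integral>\<omega>. outer (X \<omega>) (X \<omega>) \<partial>P)"
    unfolding second_moment_def by (subst integral_distr) auto
qed

text \<open>Writing \<open>X = Y + h\<close>, the mixed terms are split by Young's inequality with
  weight \<open>\<delta>\<close>, namely
  \<open>2 |h| |y| \<le> |h|^2 / \<delta> + \<delta> |y|^2\<close>. As the expectation of
  \<open>|h|^2\<close> is at most \<open>\<delta>^2\<close>, every contribution keeps a factor
  \<open>\<delta>\<close>. Only the second moment of \<open>Y\<close> enters the bound.\<close>

lemma moments_diff_le:
  assumes "prob_space P" and X: "square_integrable P X" and Y: "square_integrable P Y"
    and \<delta>: "\<delta> > 0" and D: "(\<integral>\<omega>. (norm (X \<omega> - Y \<omega>))\<^sup>2 \<partial>P) \<le> \<delta>\<^sup>2"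
  shows "norm ((\<integral>\<omega>. X \<omega> \<partial>P) - (\<integral>\<omega>. Y \<omega> \<partial>P)) \<le> \<delta>"
    "norm ((\<integral>\<omega>. outer (X \<omega>) (X \<omega>) \<partial>P) - (\<integral>\<omega>. outer (Y \<omega>) (Y \<omega>) \<partial>P))
      \<le> \<delta> * (\<delta> + 1 + (\<integral>\<omega>. (norm (Y \<omega>))\<^sup>2 \<partial>P))"
proof -
  have nY: "square_integrable P (\<lambda>\<omega>. - Y \<omega>)" using Y by (simp add: square_integrable_def)
  have S: "square_integrable P (\<lambda>\<omega>. X \<omega> - Y \<omega>)" using square_integrable_add[OF X nY] by simp
  have "(norm ((\<integral>\<omega>. X \<omega> \<partial>P) - (\<integral>\<omega>. Y \<omega> \<partial>P)))\<^sup>2 \<le> \<delta>\<^sup>2"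
    using norm_expectation_sq_le[OF assms(1) S] D
      square_integrable_integrable[OF assms(1) X] square_integrable_integrable[OF assms(1) Y] by simp
  then show "norm ((\<integral>\<omega>. X \<omega> \<partial>P) - (\<integral>\<omega>. Y \<omega> \<partial>P)) \<le> \<delta>"
    using \<delta> by (simp add: power2_le_iff_abs_le)
  let ?d = "\<lambda>\<omega>. outer (X \<omega>) (X \<omega>) - outer (Y \<omega>) (Y \<omega>)"
  let ?g = "\<lambda>\<omega>. (1 + 1 / \<delta>) * (norm (X \<omega> - Y \<omega>))\<^sup>2 + \<delta> * (norm (Y \<omega>))\<^sup>2"
  have i: "integrable P ?d" using integrable_outer[OF X X] integrable_outer[OF Y Y] by simp
  have ig: "integrable P ?g" using square_integrableD(2)[OF S] square_integrableD(2)[OF Y] by simp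
  have b: "norm (?d \<omega>) \<le> ?g \<omega>" for \<omega>
  proof -
    define h y where "h = X \<omega> - Y \<omega>" "y = Y \<omega>"
    have "0 \<le> (norm h - \<delta> * norm y)\<^sup>2 / \<delta>" using \<delta> by simp
    also have "\<dots> = (norm h)\<^sup>2 / \<delta> + \<delta> * (norm y)\<^sup>2 - 2 * (norm h * norm y)"
      using \<delta> by (simp add: power2_diff field_simps power2_eq_square)
    finally have young: "2 * (norm h * norm y) \<le> (norm h)\<^sup>2 / \<delta> + \<delta> * (norm y)\<^sup>2" by simp
    have "?d \<omega> = outer h h + outer h y + outer y h"
      by (simp add: h_y_def outer_simps)
    then have "norm (?d \<omega>) \<le> norm (outer h h) + norm (outer h y) + norm (outer y h)"
      by (simp only:) (intro order_trans[OF norm_triangle_ineq] add_right_mono norm_triangle_ineq)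
    also have "\<dots> = (norm h)\<^sup>2 + 2 * (norm h * norm y)"
      by (simp add: norm_outer power2_eq_square)
    also have "\<dots> \<le> (1 + 1 / \<delta>) * (norm h)\<^sup>2 + \<delta> * (norm y)\<^sup>2"
      using young by (simp add: distrib_right)
    finally show ?thesis by (simp add: h_y_def)
  qed
  have "norm ((\<integral>\<omega>. outer (X \<omega>) (X \<omega>) \<partial>P) - (\<integral>\<omega>. outer (Y \<omega>) (Y \<omega>) \<partial>P)) = norm (\<integral>\<omega>. ?d \<omega> \<partial>P)"
    using integrable_outer[OF X X] integrable_outer[OF Y Y] by simp
  also have "\<dots> \<le> (\<integral>\<omega>. norm (?d \<omega>) \<partial>P)" by (rule integral_norm_bound)
  also have "\<dots> \<le> (\<integral>\<omega>. ?g \<omega> \<partial>P)" using b i ig by (intro integral_mono) auto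
  also have "\<dots> = (1 + 1 / \<delta>) * (\<integral>\<omega>. (norm (X \<omega> - Y \<omega>))\<^sup>2 \<partial>P) + \<delta> * (\<integral>\<omega>. (norm (Y \<omega>))\<^sup>2 \<partial>P)"
    using square_integrableD(2)[OF S] square_integrableD(2)[OF Y] by simp
  also have "\<dots> \<le> (1 + 1 / \<delta>) * \<delta>\<^sup>2 + \<delta> * (\<integral>\<omega>. (norm (Y \<omega>))\<^sup>2 \<partial>P)"
    using \<delta> D by (intro add_right_mono mult_left_mono) auto
  also have "\<dots> = \<delta> * (\<delta> + 1 + (\<integral>\<omega>. (norm (Y \<omega>))\<^sup>2 \<partial>P))"
    using \<delta> by (simp add: field_simps power2_eq_square)
  finally show "norm ((\<integral>\<omega>. outer (X \<omega>) (X \<omega>) \<partial>P) - (\<integral>\<omega>. outer (Y \<omega>) (Y \<omega>) \<partial>P))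
      \<le> \<delta> * (\<delta> + 1 + (\<integral>\<omega>. (norm (Y \<omega>))\<^sup>2 \<partial>P))" .
qed

text \<open>Ensures that the infimum in \<open>W2\<close> runs over a nonempty set, so that a nearly
  optimal coupling can be selected.\<close>

lemma pair_measure_in_couplings:
  assumes "\<mu> \<in> P2" "\<nu> \<in> P2"
  shows "\<mu> \<Otimes>\<^sub>M \<nu> \<in> couplings \<mu> \<nu>"
proof -
  interpret M: prob_space \<mu> using assms by (simp add: P2_prob_space)
  interpret N: prob_space \<nu> using assms by (simp add: P2_prob_space)
  interpret MN: pair_prob_space \<mu> \<nu> ..
  interpret NM: pair_prob_space \<nu> \<mu> ..
  have s [measurable_cong]: "sets \<mu> = sets borel" "sets \<nu> = sets borel"
    using assms by (simp_all add: P2_def)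
  have "sets (\<mu> \<Otimes>\<^sub>M \<nu>) = sets borel"
    using sets_pair_measure_cong[OF s] unfolding borel_prod .
  moreover have "distr (\<mu> \<Otimes>\<^sub>M \<nu>) borel fst = \<mu>"
    using N.distr_pair_fst[of \<mu>] distr_cong[OF refl s(1), of "\<mu> \<Otimes>\<^sub>M \<nu>" fst fst] by simp
  moreover have "distr (\<mu> \<Otimes>\<^sub>M \<nu>) borel snd = \<nu>"
  proof -
    have "distr (\<mu> \<Otimes>\<^sub>M \<nu>) borel snd
        = distr (distr (\<nu> \<Otimes>\<^sub>M \<mu>) (\<mu> \<Otimes>\<^sub>M \<nu>) (\<lambda>(x, y). (y, x))) borel snd"
      using MN.distr_pair_swap by simp
    also have "\<dots> = distr (\<nu> \<Otimes>\<^sub>M \<mu>) borel fst"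
      by (subst distr_distr) (auto simp: o_def split_beta')
    also have "\<dots> = \<nu>"
      using M.distr_pair_fst[of \<nu>] distr_cong[OF refl s(2), of "\<nu> \<Otimes>\<^sub>M \<mu>" fst fst] by simp
    finally show ?thesis .
  qed
  ultimately show ?thesis by (simp add: couplings_def MN.prob_space_axioms)
qed

text \<open>A coupling with cost below \<open>\<delta>\<^sup>2\<close> suffices; no optimal one is
  needed. Its coordinate projections are random vectors with laws \<open>\<nu>\<close> and
  \<open>\<mu>\<close>. The bound involves only the reference measure \<open>\<mu>\<close>, hence is
  uniform over the \<open>\<nu>\<close> near it.\<close>

lemma W2_less_moments:
  fixes \<mu> \<nu> :: "(real ^ 'i) measure"
  assumes \<nu>: "\<nu> \<in> P2" and \<mu>: "\<mu> \<in> P2" and \<delta>: "\<delta> > 0" and less: "W2 \<nu> \<mu> < \<delta>"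
  shows "norm (mean \<nu> - mean \<mu>) \<le> \<delta>"
    "norm (second_moment \<nu> - second_moment \<mu>) \<le> \<delta> * (\<delta> + 1 + (\<integral>x. (norm x)\<^sup>2 \<partial>\<mu>))"
proof -
  let ?D = "\<lambda>\<pi> :: ((real ^ 'i) \<times> (real ^ 'i)) measure. \<integral>z. (norm (fst z - snd z))\<^sup>2 \<partial>\<pi>"
  have "(INF \<pi>\<in>couplings \<nu> \<mu>. ?D \<pi>) < \<delta>\<^sup>2"
    using less \<delta> unfolding W2_def by (meson not_le real_le_rsqrt)
  moreover have "bdd_below (?D ` couplings \<nu> \<mu>)" by (rule bdd_belowI2[of _ 0]) simp
  moreover have "couplings \<nu> \<mu> \<noteq> {}" using pair_measure_in_couplings[OF \<nu> \<mu>] by blast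
  ultimately obtain \<pi> where \<pi>: "\<pi> \<in> couplings \<nu> \<mu>" and D: "?D \<pi> < \<delta>\<^sup>2"
    by (auto simp: cINF_less_iff)
  have P: "prob_space \<pi>" and s: "sets \<pi> = sets borel"
    and d: "distr \<pi> borel fst = \<nu>" "distr \<pi> borel snd = \<mu>" using \<pi> by (auto simp: couplings_def)
  have m: "fst \<in> borel_measurable \<pi>" "snd \<in> borel_measurable \<pi>"
    using measurable_cong_sets[OF s refl, of "borel :: (real ^ 'i) measure"] borel_measurable_continuous_onI[OF continuous_on_fst[OF continuous_on_id]]
      borel_measurable_continuous_onI[OF continuous_on_snd[OF continuous_on_id]] by auto
  have sq: "square_integrable \<pi> fst" "square_integrable \<pi> snd"
    using \<nu> \<mu> m d integrable_distr_eq[OF m(1), of "\<lambda>x. (norm x)\<^sup>2"]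
      integrable_distr_eq[OF m(2), of "\<lambda>x. (norm x)\<^sup>2"]
    by (simp_all add: square_integrable_def P2_def)
  have E: "(\<integral>z. (norm (snd z))\<^sup>2 \<partial>\<pi>) = (\<integral>x. (norm x)\<^sup>2 \<partial>\<mu>)"
    unfolding d(2)[symmetric] by (subst integral_distr) (auto simp: m)
  show "norm (mean \<nu> - mean \<mu>) \<le> \<delta>"
    "norm (second_moment \<nu> - second_moment \<mu>) \<le> \<delta> * (\<delta> + 1 + (\<integral>x. (norm x)\<^sup>2 \<partial>\<mu>))"
    using moments_diff_le[OF P sq \<delta> less_imp_le[OF D]] moments_distr[OF sq(1)] moments_distr[OF sq(2)]
    by (simp_all add: d E)
qed

text \<open>Every function occurring in the solution depends on the measure through its first two
  moments only, so continuity on the Wasserstein space reduces to continuity in finitely many real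
  variables.\<close>

lemma jointly_continuous_moments:
  fixes g :: "real \<times> (real ^ 'i) \<times> (real ^ 'i ^ 'i) \<times> (real ^ 'i) \<Rightarrow> 'c::metric_space"
  assumes g: "continuous_on (I \<times> UNIV) g"
  shows "jointly_continuous I (\<lambda>t \<mu> x. g (t, mean \<mu>, second_moment \<mu>, x))"
  unfolding jointly_continuous_def
proof (intro ballI allI impI)
  fix t and \<mu> :: "(real ^ 'i) measure" and x and \<epsilon> :: real
  assume t: "t \<in> I" and \<mu>: "\<mu> \<in> P2" and "\<epsilon> > 0"
  then obtain d where d: "d > 0"
    and dist_g: "\<And>z. z \<in> I \<times> UNIV \<Longrightarrow> dist z (t, mean \<mu>, second_moment \<mu>, x) < d
      \<Longrightarrow> dist (g z) (g (t, mean \<mu>, second_moment \<mu>, x)) < \<epsilon>"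
    using g[unfolded continuous_on_iff, rule_format, of "(t, mean \<mu>, second_moment \<mu>, x)" \<epsilon>] by auto
  define M where "M = (\<integral>x. (norm x)\<^sup>2 \<partial>\<mu>)"
  have M: "M \<ge> 0" by (simp add: M_def)
  \<comment> \<open>The cap 1 turns \<open>\<delta> + 1 + M\<close> into at most
    \<open>M + 2\<close>; the quotient then makes each of the four components of the distance at
    most \<open>d / 8\<close>.\<close>
  define \<delta> where "\<delta> = min 1 (d / (8 * (M + 2)))"
  have \<delta>: "\<delta> > 0" "\<delta> \<le> 1" using d M by (auto simp: \<delta>_def)
  have \<delta>M: "\<delta> * (M + 2) \<le> d / 8"
  proof -
    have "\<delta> * (M + 2) \<le> d / (8 * (M + 2)) * (M + 2)"
      using M by (intro mult_right_mono) (auto simp: \<delta>_def)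
    also have "\<dots> = d / 8" using M by (simp add: field_simps)
    finally show ?thesis .
  qed
  have \<delta>d: "\<delta> \<le> d / 8"
    using \<delta>M mult_left_mono[of 1 "M + 2" \<delta>] M \<delta> by linarith
  show "\<exists>\<delta>>0. \<forall>s\<in>I. \<forall>\<nu>\<in>P2. \<forall>y. dist s t < \<delta> \<and> W2 \<nu> \<mu> < \<delta> \<and> dist y x < \<delta> \<longrightarrow>
      dist (g (s, mean \<nu>, second_moment \<nu>, y)) (g (t, mean \<mu>, second_moment \<mu>, x)) < \<epsilon>"
  proof (intro exI[of _ \<delta>] conjI ballI allI impI \<delta>(1))
    fix s \<nu> y assume s: "s \<in> I" and \<nu>: "\<nu> \<in> P2" and a: "dist s t < \<delta> \<and> W2 \<nu> \<mu> < \<delta> \<and> dist y x < \<delta>"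
    have m: "dist (mean \<nu>) (mean \<mu>) \<le> \<delta>"
      using W2_less_moments(1)[OF \<nu> \<mu> \<delta>(1)] a by (simp add: dist_norm)
    have "dist (second_moment \<nu>) (second_moment \<mu>) \<le> \<delta> * (\<delta> + 1 + M)"
      using W2_less_moments(2)[OF \<nu> \<mu> \<delta>(1)] a by (simp add: dist_norm M_def)
    also have "\<dots> \<le> \<delta> * (M + 2)" using \<delta> by (intro mult_left_mono) auto
    finally have S: "dist (second_moment \<nu>) (second_moment \<mu>) \<le> d / 8" using \<delta>M by linarith
    have pair: "dist (u, v) (u', v') \<le> dist u u' + dist v v'" for u u' :: "'x::metric_space" and v v' :: "'y::metric_space"
      by (simp add: dist_Pair_Pair sqrt_sum_squares_le_sum)
    have "dist (s, mean \<nu>, second_moment \<nu>, y) (t, mean \<mu>, second_moment \<mu>, x)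
        \<le> dist s t + (dist (mean \<nu>) (mean \<mu>) + (dist (second_moment \<nu>) (second_moment \<mu>) + dist y x))"
      by (intro order_trans[OF pair] add_left_mono order_refl)
    also have "\<dots> < d" using a m S \<delta>d d by linarith
    finally show "dist (g (s, mean \<nu>, second_moment \<nu>, y)) (g (t, mean \<mu>, second_moment \<mu>, x)) < \<epsilon>"
      using s by (intro dist_g) auto
  qed
qed

subsection \<open>Quadratic functionals of measures\<close>

text \<open>The ansatz expressed through moments. The terminal cost and the time derivative of the
  ansatz are again of this form, so the equation can be checked by comparing coefficients.\<close>

definition quad_functional ::
  "real ^ 'i ^ 'i \<Rightarrow> real ^ 'i \<Rightarrow> real ^ 'i ^ 'i \<Rightarrow> real \<Rightarrow> (real ^ 'i) measure \<Rightarrow> real" where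
  "quad_functional A b D e \<mu> =
    A \<bullet> second_moment \<mu> + b \<bullet> mean \<mu> + mean \<mu> \<bullet> (D *v mean \<mu>) + e"

lemma integral_quadratic:
  assumes "\<mu> \<in> P2"
  shows "integrable \<mu> (\<lambda>x. x \<bullet> (A *v x) + b \<bullet> x)"
    "(\<integral>x. x \<bullet> (A *v x) + b \<bullet> x \<partial>\<mu>) = A \<bullet> second_moment \<mu> + b \<bullet> mean \<mu>"
  unfolding inner_outer[symmetric] second_moment_def mean_def
  using P2_integrable[OF assms] by simp_all

lemma quad_functional_eq_integral:
  assumes "\<mu> \<in> P2"
  shows "quad_functional A b D e \<mu> = (\<integral>x. x \<bullet> (A *v x) + b \<bullet> x \<partial>\<mu>)
    + (\<integral>x. (\<integral>y. x \<bullet> (D *v y) \<partial>\<mu>) \<partial>\<mu>) + e"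
proof -
  have "(\<integral>y. x \<bullet> (D *v y) \<partial>\<mu>) = x \<bullet> (D *v mean \<mu>)" for x
    using P2_integrable(1)[OF assms]
    unfolding mean_def by (simp flip: dot_lmul_matrix)
  then have "(\<integral>x. (\<integral>y. x \<bullet> (D *v y) \<partial>\<mu>) \<partial>\<mu>) = mean \<mu> \<bullet> (D *v mean \<mu>)"
    using P2_integrable(1)[OF assms] by (simp add: mean_def)
  then show ?thesis by (simp add: quad_functional_def integral_quadratic(2)[OF assms])
qed

lemma quad_U_eq_quad_functional:
  assumes "\<mu> \<in> P2"
  shows "quad_U A D b \<mu> = quad_functional A b D 0 \<mu>"
  using integral_quadratic(2)[OF assms, of A b]
  by (simp add: quad_U_def quad_functional_def quad_form_def mean_def inner_commute)

lemma square_integrable_affine: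
  fixes A :: "real ^ 'i ^ 'i"
  assumes "prob_space P" "square_integrable P X"
  shows "square_integrable P (\<lambda>\<omega>. A *v X \<omega> + b)"
proof (rule square_integrable_add)
  interpret prob_space P by fact
  show "square_integrable P (\<lambda>\<omega>. b)" by (simp add: square_integrable_def)
  have bl: "bounded_linear ((*v) A)" by (rule matrix_vector_mul_bounded_linear)
  obtain K where K: "\<And>x. norm (A *v x) \<le> norm x * K" using bounded_linear.bounded[OF bl] by blast
  have m: "(\<lambda>\<omega>. A *v X \<omega>) \<in> borel_measurable P"
    using assms(2) by (intro borel_measurable_continuous_on[OF linear_continuous_on[OF bl]])
      (simp add: square_integrableD)
  moreover have "integrable P (\<lambda>\<omega>. (norm (A *v X \<omega>))\<^sup>2)"
  proof (rule Bochner_Integration.integrable_bound)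
    show "integrable P (\<lambda>\<omega>. (norm (X \<omega>))\<^sup>2 * K\<^sup>2)"
      using square_integrableD(2)[OF assms(2)] by simp
    show "AE \<omega> in P. norm ((norm (A *v X \<omega>))\<^sup>2) \<le> norm ((norm (X \<omega>))\<^sup>2 * K\<^sup>2)"
      using power_mono[OF K norm_ge_zero, of _ 2] by (simp add: power_mult_distrib)
    show "(\<lambda>\<omega>. (norm (A *v X \<omega>))\<^sup>2) \<in> borel_measurable P" using m by measurable
  qed
  ultimately show "square_integrable P (\<lambda>\<omega>. A *v X \<omega>)" by (simp add: square_integrable_def)
qed

text \<open>The functional is quadratic in the random vector, so after subtracting the linear term
  the remainder is exactly the functional's quadratic part evaluated at the perturbation, which is
  of second order in its \<open>L2_norm\<close>.\<close>

lemma has_wasserstein_derivative_quad_functional: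
  fixes A D :: "real ^ 'i ^ 'i"
  assumes A: "transpose A = A" and D: "transpose D = D" and \<mu>: "\<mu> \<in> P2"
  shows "has_wasserstein_derivative (quad_functional A b D e)
    (\<lambda>x. 2 *\<^sub>R (A *v x) + b + 2 *\<^sub>R (D *v mean \<mu>)) \<mu>"
  unfolding has_wasserstein_derivative_def
proof (intro conjI allI impI)
  have "square_integrable \<mu> (\<lambda>x. (2 *\<^sub>R A) *v x + (b + 2 *\<^sub>R (D *v mean \<mu>)))"
    by (intro square_integrable_affine P2_prob_space P2_square_integrable \<mu>)
  then show "square_integrable \<mu> (\<lambda>x. 2 *\<^sub>R (A *v x) + b + 2 *\<^sub>R (D *v mean \<mu>))"
    by (simp add: matrix_vector_bilinear_simps add.assoc)
next
  fix \<epsilon> :: real assume \<epsilon>: "\<epsilon> > 0"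
  \<comment> \<open>The constant bounds both parts of the remainder; the summand 1 makes it
    positive, so that \<open>\<epsilon> / K\<close> can serve as the radius.\<close>
  define K where "K = norm A + onorm ((*v) D) + 1"
  note onD = onorm[OF matrix_vector_mul_bounded_linear, of D]
  have onD_pos: "onorm ((*v) D) \<ge> 0" by (rule onorm_pos_le) (rule matrix_vector_mul_bounded_linear)
  have K: "K > 0" unfolding K_def using onD_pos norm_ge_zero[of A] by linarith
  show "\<exists>\<delta>>0. \<forall>(P :: ((real ^ 'i) \<times> (real ^ 'i)) measure) \<xi> \<eta>.
      prob_space P \<and> square_integrable P \<xi> \<and> square_integrable P \<eta> \<and>
      distr P borel \<xi> = \<mu> \<and> L2_norm P \<eta> < \<delta> \<longrightarrow>
      \<bar>quad_functional A b D e (distr P borel (\<lambda>\<omega>. \<xi> \<omega> + \<eta> \<omega>)) - quad_functional A b D e (distr P borel \<xi>)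
        - (\<integral>\<omega>. (2 *\<^sub>R (A *v \<xi> \<omega>) + b + 2 *\<^sub>R (D *v mean \<mu>)) \<bullet> \<eta> \<omega> \<partial>P)\<bar> \<le> \<epsilon> * L2_norm P \<eta>"
  proof (intro exI[of _ "\<epsilon> / K"] conjI allI impI)
    show "\<epsilon> / K > 0" using \<epsilon> K by simp
    fix P :: "((real ^ 'i) \<times> (real ^ 'i)) measure"
      and \<xi> \<eta> :: "(real ^ 'i) \<times> (real ^ 'i) \<Rightarrow> real ^ 'i"
    assume a: "prob_space P \<and> square_integrable P \<xi> \<and> square_integrable P \<eta> \<and>
      distr P borel \<xi> = \<mu> \<and> L2_norm P \<eta> < \<epsilon> / K"
    then have P: "prob_space P" and \<xi>: "square_integrable P \<xi>" and \<eta>: "square_integrable P \<eta>"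
      and d: "distr P borel \<xi> = \<mu>" and small: "L2_norm P \<eta> < \<epsilon> / K" by auto
    define m h where "m = (\<integral>\<omega>. \<xi> \<omega> \<partial>P)" "h = (\<integral>\<omega>. \<eta> \<omega> \<partial>P)"
    note i\<xi> = square_integrable_integrable[OF P \<xi>] and i\<eta> = square_integrable_integrable[OF P \<eta>]
    note o\<xi>\<xi> = integrable_outer[OF \<xi> \<xi>] and o\<xi>\<eta> = integrable_outer[OF \<xi> \<eta>]
      and o\<eta>\<xi> = integrable_outer[OF \<eta> \<xi>] and o\<eta>\<eta> = integrable_outer[OF \<eta> \<eta>]
    have m: "mean \<mu> = m" using moments_distr(1)[OF \<xi>] d by (simp add: m_h_def)
    have "quad_functional A b D e (distr P borel (\<lambda>\<omega>. \<xi> \<omega> + \<eta> \<omega>))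
        = A \<bullet> (\<integral>\<omega>. outer (\<xi> \<omega>) (\<xi> \<omega>) \<partial>P) + 2 * (A \<bullet> (\<integral>\<omega>. outer (\<eta> \<omega>) (\<xi> \<omega>) \<partial>P))
          + A \<bullet> (\<integral>\<omega>. outer (\<eta> \<omega>) (\<eta> \<omega>) \<partial>P)
          + b \<bullet> (m + h) + (m + h) \<bullet> (D *v (m + h)) + e"
    proof -
      have "(\<integral>\<omega>. outer (\<xi> \<omega> + \<eta> \<omega>) (\<xi> \<omega> + \<eta> \<omega>) \<partial>P)
        = (\<integral>\<omega>. outer (\<xi> \<omega>) (\<xi> \<omega>) \<partial>P) + (\<integral>\<omega>. outer (\<xi> \<omega>) (\<eta> \<omega>) \<partial>P)
          + ((\<integral>\<omega>. outer (\<eta> \<omega>) (\<xi> \<omega>) \<partial>P) + (\<integral>\<omega>. outer (\<eta> \<omega>) (\<eta> \<omega>) \<partial>P))"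
        using o\<xi>\<xi> o\<xi>\<eta> o\<eta>\<xi> o\<eta>\<eta> by (simp add: outer_simps algebra_simps)
      \<comment> \<open>Symmetry of \<open>A\<close> merges the two mixed moments, which is the
        origin of the factor 2 in the derivative.\<close>
      moreover have "A \<bullet> (\<integral>\<omega>. outer (\<xi> \<omega>) (\<eta> \<omega>) \<partial>P) = A \<bullet> (\<integral>\<omega>. outer (\<eta> \<omega>) (\<xi> \<omega>) \<partial>P)"
      proof -
        have "A \<bullet> (\<integral>\<omega>. outer (\<xi> \<omega>) (\<eta> \<omega>) \<partial>P) = (\<integral>\<omega>. A \<bullet> outer (\<xi> \<omega>) (\<eta> \<omega>) \<partial>P)"
          using o\<xi>\<eta> by simp
        also have "\<dots> = (\<integral>\<omega>. A \<bullet> outer (\<eta> \<omega>) (\<xi> \<omega>) \<partial>P)"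
          by (simp only: inner_outer symmetric_matrix_inner_commute[OF A])
        finally show ?thesis using o\<eta>\<xi> by simp
      qed
      ultimately show ?thesis
        unfolding quad_functional_def moments_distr[OF square_integrable_add[OF \<xi> \<eta>]]
        using i\<xi> i\<eta> by (simp add: m_h_def inner_add_right)
    qed
    moreover have "quad_functional A b D e (distr P borel \<xi>)
        = A \<bullet> (\<integral>\<omega>. outer (\<xi> \<omega>) (\<xi> \<omega>) \<partial>P) + b \<bullet> m + m \<bullet> (D *v m) + e"
      unfolding quad_functional_def moments_distr[OF \<xi>] by (simp add: m_h_def)
    moreover have "(\<integral>\<omega>. (2 *\<^sub>R (A *v \<xi> \<omega>) + b + 2 *\<^sub>R (D *v mean \<mu>)) \<bullet> \<eta> \<omega> \<partial>P)
        = 2 * (A \<bullet> (\<integral>\<omega>. outer (\<eta> \<omega>) (\<xi> \<omega>) \<partial>P)) + b \<bullet> h + 2 * (h \<bullet> (D *v m))"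
    proof -
      have "(2 *\<^sub>R (A *v \<xi> \<omega>) + b + 2 *\<^sub>R (D *v mean \<mu>)) \<bullet> \<eta> \<omega>
          = 2 * (A \<bullet> outer (\<eta> \<omega>) (\<xi> \<omega>)) + (b + 2 *\<^sub>R (D *v m)) \<bullet> \<eta> \<omega>" for \<omega>
        by (simp add: inner_outer m inner_add_left inner_add_right inner_commute)
      then have "(\<integral>\<omega>. (2 *\<^sub>R (A *v \<xi> \<omega>) + b + 2 *\<^sub>R (D *v mean \<mu>)) \<bullet> \<eta> \<omega> \<partial>P)
          = (\<integral>\<omega>. 2 * (A \<bullet> outer (\<eta> \<omega>) (\<xi> \<omega>)) + (b + 2 *\<^sub>R (D *v m)) \<bullet> \<eta> \<omega> \<partial>P)"
        by (simp only:)
      also have "\<dots> = 2 * (A \<bullet> (\<integral>\<omega>. outer (\<eta> \<omega>) (\<xi> \<omega>) \<partial>P)) + (b + 2 *\<^sub>R (D *v m)) \<bullet> h"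
        using o\<eta>\<xi> i\<eta> by (simp add: m_h_def(2))
      finally show ?thesis by (simp add: inner_add_right inner_commute[of _ h])
    qed
    ultimately have eq: "quad_functional A b D e (distr P borel (\<lambda>\<omega>. \<xi> \<omega> + \<eta> \<omega>))
          - quad_functional A b D e (distr P borel \<xi>)
          - (\<integral>\<omega>. (2 *\<^sub>R (A *v \<xi> \<omega>) + b + 2 *\<^sub>R (D *v mean \<mu>)) \<bullet> \<eta> \<omega> \<partial>P)
        = A \<bullet> (\<integral>\<omega>. outer (\<eta> \<omega>) (\<eta> \<omega>) \<partial>P) + h \<bullet> (D *v h)"
      using symmetric_matrix_inner_commute[OF D, of m h]
      by (simp add: matrix_vector_bilinear_simps inner_add_left inner_add_right)
    have L2: "(L2_norm P \<eta>)\<^sup>2 = (\<integral>\<omega>. (norm (\<eta> \<omega>))\<^sup>2 \<partial>P)" by (simp add: L2_norm_def)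
    have "\<bar>A \<bullet> (\<integral>\<omega>. outer (\<eta> \<omega>) (\<eta> \<omega>) \<partial>P)\<bar> \<le> norm A * (L2_norm P \<eta>)\<^sup>2"
    proof -
      have "norm (\<integral>\<omega>. outer (\<eta> \<omega>) (\<eta> \<omega>) \<partial>P) \<le> (\<integral>\<omega>. norm (outer (\<eta> \<omega>) (\<eta> \<omega>)) \<partial>P)"
        by (rule integral_norm_bound)
      also have "\<dots> = (L2_norm P \<eta>)\<^sup>2" unfolding L2 by (simp add: norm_outer power2_eq_square)
      finally show ?thesis
        by (intro order_trans[OF Cauchy_Schwarz_ineq2] mult_left_mono) auto
    qed
    moreover have "\<bar>h \<bullet> (D *v h)\<bar> \<le> onorm ((*v) D) * (L2_norm P \<eta>)\<^sup>2"
    proof -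
      have "\<bar>h \<bullet> (D *v h)\<bar> \<le> norm h * (onorm ((*v) D) * norm h)"
        by (intro order_trans[OF Cauchy_Schwarz_ineq2] mult_left_mono onD) auto
      also have "\<dots> = onorm ((*v) D) * (norm h)\<^sup>2" by (simp add: power2_eq_square)
      also have "\<dots> \<le> onorm ((*v) D) * (L2_norm P \<eta>)\<^sup>2"
        using norm_expectation_sq_le[OF P \<eta>] onD_pos
        by (intro mult_left_mono) (simp_all add: L2 m_h_def)
      finally show ?thesis .
    qed
    ultimately have "\<bar>A \<bullet> (\<integral>\<omega>. outer (\<eta> \<omega>) (\<eta> \<omega>) \<partial>P) + h \<bullet> (D *v h)\<bar> \<le> K * (L2_norm P \<eta>)\<^sup>2"
      unfolding K_def distrib_right
      using abs_triangle_ineq[of "A \<bullet> (\<integral>\<omega>. outer (\<eta> \<omega>) (\<eta> \<omega>) \<partial>P)" "h \<bullet> (D *v h)"]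
        zero_le_power2[of "L2_norm P \<eta>"] by linarith
    also have "\<dots> = (K * L2_norm P \<eta>) * L2_norm P \<eta>" by (simp add: power2_eq_square)
    also have "\<dots> \<le> \<epsilon> * L2_norm P \<eta>"
    proof (rule mult_right_mono)
      show "K * L2_norm P \<eta> \<le> \<epsilon>" using small K by (simp add: field_simps)
      show "0 \<le> L2_norm P \<eta>" by (simp add: L2_norm_def)
    qed
    finally show "\<bar>quad_functional A b D e (distr P borel (\<lambda>\<omega>. \<xi> \<omega> + \<eta> \<omega>)) - quad_functional A b D e (distr P borel \<xi>)
        - (\<integral>\<omega>. (2 *\<^sub>R (A *v \<xi> \<omega>) + b + 2 *\<^sub>R (D *v mean \<mu>)) \<bullet> \<eta> \<omega> \<partial>P)\<bar> \<le> \<epsilon> * L2_norm P \<eta>"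
      unfolding eq .
  qed
qed

lemma jointly_continuous_quad_functional:
  assumes "continuous_on I A" "continuous_on I b" "continuous_on I D" "continuous_on I e"
  shows "jointly_continuous I (\<lambda>t \<mu> x. quad_functional (A t) (b t) (D t) (e t) \<mu>)"
proof -
  have c: "continuous_on (I \<times> UNIV) (\<lambda>z. f (fst z))" if "continuous_on I f" for f :: "real \<Rightarrow> 'z::topological_space"
    by (rule continuous_on_compose2[OF that]) (auto intro!: continuous_intros)
  have "continuous_on (I \<times> UNIV) (\<lambda>(t, m, S, x). A t \<bullet> S + b t \<bullet> m + m \<bullet> (D t *v m) + e t)"
    unfolding split_beta
    by (intro continuous_intros c assms bounded_bilinear.continuous_on[OF bounded_bilinear_matrix_vector_mult])
  from jointly_continuous_moments[OF this] show ?thesis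
    by (simp add: quad_functional_def)
qed

lemma jointly_continuous_quad_functional_derivative:
  fixes A D :: "real \<Rightarrow> real ^ 'i ^ 'i"
  assumes "continuous_on I A" "continuous_on I b" "continuous_on I D"
  shows "jointly_continuous I (\<lambda>t \<mu> x. 2 *\<^sub>R (A t *v x) + b t + 2 *\<^sub>R (D t *v mean \<mu>))"
    "jointly_continuous I (\<lambda>t \<mu> (x :: real ^ 'i). 2 *\<^sub>R A t)"
proof -
  have c: "continuous_on (I \<times> UNIV) (\<lambda>z. f (fst z))" if "continuous_on I f" for f :: "real \<Rightarrow> 'z::topological_space"
    by (rule continuous_on_compose2[OF that]) (auto intro!: continuous_intros)
  have "continuous_on (I \<times> UNIV) (\<lambda>(t, m, S, x). 2 *\<^sub>R (A t *v x) + b t + 2 *\<^sub>R (D t *v m))"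
    unfolding split_beta
    by (intro continuous_intros c assms bounded_bilinear.continuous_on[OF bounded_bilinear_matrix_vector_mult])
  from jointly_continuous_moments[OF this]
  show "jointly_continuous I (\<lambda>t \<mu> x. 2 *\<^sub>R (A t *v x) + b t + 2 *\<^sub>R (D t *v mean \<mu>))" by simp
  have "continuous_on (I \<times> UNIV) (\<lambda>(t, m :: real ^ 'i, S :: real ^ 'i ^ 'i, x :: real ^ 'i). 2 *\<^sub>R A t)"
    unfolding split_beta by (intro continuous_intros c assms)
  from jointly_continuous_moments[OF this]
  show "jointly_continuous I (\<lambda>t \<mu> (x :: real ^ 'i). 2 *\<^sub>R A t)" by simp
qed

section \<open>The quadratic Hamiltonian on push-forwards\<close>

lemma matrix_mult_stack:
  "Q *v stack x p = stack (block11 Q *v x + block12 Q *v p) (block21 Q *v x + block22 Q *v p)"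
proof -
  have UNIV_sum: "(\<Sum>k\<in>UNIV. f k) = (\<Sum>i\<in>UNIV. f (Inl i)) + (\<Sum>j\<in>UNIV. f (Inr j))" for f :: "'a + 'a \<Rightarrow> real"
    using sum.Plus[of UNIV UNIV f] by simp
  show ?thesis
    by (rule vec_sum_eqI)
      (simp_all add: matrix_vector_mult_def UNIV_sum block11_def block12_def block21_def block22_def)
qed

lemma inner_stack: "stack x p \<bullet> stack y q = x \<bullet> y + p \<bullet> q"
  using sum.Plus[of UNIV UNIV "\<lambda>k. stack x p $ k * stack y q $ k"] by (simp add: inner_vec_def)

lemma quad_form_stack:
  assumes "transpose Q = Q"
  shows "quad_form Q (stack x p) = x \<bullet> (block11 Q *v x) + 2 * (x \<bullet> (block12 Q *v p)) + p \<bullet> (block22 Q *v p)"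
  by (simp add: quad_form_def matrix_mult_stack inner_stack inner_add_right symmetric_blocks[OF assms]
      dot_lmul_matrix inner_commute[of p])

text \<open>For a fixed measure the derivative of the ansatz is affine in \<open>x\<close>, and
  \<open>k\<close> collects its constant part \<open>b + 2 D m\<close>. The coefficient of the
  second moment is then the Riccati expression for \<open>A\<close> alone; the mean interaction
  enters only through \<open>k\<close> and \<open>m\<close>.\<close>

lemma quad_H_quad_functional:
  fixes A :: "real ^ 'i ^ 'i"
  assumes A: "transpose A = A" and Q1: "transpose Q1 = Q1" and Q2: "transpose Q2 = Q2" and \<mu>: "\<mu> \<in> P2"
  defines "m \<equiv> mean \<mu>"
  shows "quad_H Q1 Q2 (c1, c2) (distr \<mu> borel (\<lambda>x. (x, 2 *\<^sub>R (A *v x) + k)))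
    = (block11 Q1 + 4 *\<^sub>R (A ** block22 Q1 ** A) + 2 *\<^sub>R (A ** block21 Q1) + 2 *\<^sub>R (block12 Q1 ** A))
        \<bullet> second_moment \<mu>
      + (2 *\<^sub>R (block12 Q1 *v k) + 4 *\<^sub>R (A *v (block22 Q1 *v k)) + c1 + 2 *\<^sub>R (A *v c2)) \<bullet> m
      + k \<bullet> (block22 Q1 *v k) + k \<bullet> c2
      + m \<bullet> (block11 Q2 *v m) + 2 * (m \<bullet> (block12 Q2 *v (2 *\<^sub>R (A *v m) + k)))
      + (2 *\<^sub>R (A *v m) + k) \<bullet> (block22 Q2 *v (2 *\<^sub>R (A *v m) + k))"
proof -
  interpret prob_space \<mu> using \<mu> by (rule P2_prob_space)
  have s [measurable_cong]: "sets \<mu> = sets borel" using \<mu> by (simp add: P2_def)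
  define N where "N = block11 Q1 + 4 *\<^sub>R (A ** block22 Q1 ** A) + 2 *\<^sub>R (A ** block21 Q1) + 2 *\<^sub>R (block12 Q1 ** A)"
  define w where "w = 2 *\<^sub>R (block12 Q1 *v k) + 4 *\<^sub>R (A *v (block22 Q1 *v k)) + c1 + 2 *\<^sub>R (A *v c2)"
  have cA: "continuous_on UNIV (\<lambda>x. A *v x)" for A :: "real ^ 'a ^ 'b"
    by (rule linear_continuous_on[OF matrix_vector_mul_bounded_linear])
  have mA: "(\<lambda>x. (x, 2 *\<^sub>R (A *v x) + k)) \<in> \<mu> \<rightarrow>\<^sub>M borel"
    unfolding measurable_cong_sets[OF s refl]
    by (intro borel_measurable_continuous_onI continuous_intros cA)
  have mf: "(\<lambda>z :: (real ^ 'i) \<times> (real ^ 'i). quad_form Q1 (stack (fst z) (snd z)) + z \<bullet> (c1, c2)) \<in> borel_measurable borel"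
    unfolding quad_form_stack[OF Q1]
    by (intro borel_measurable_continuous_onI continuous_intros continuous_on_compose2[OF cA]) auto
  \<comment> \<open>Pulled back to \<open>x\<close>, the integrand is a quadratic polynomial with
    matrix \<open>N\<close>, linear part \<open>w\<close> and constant term, so integration produces
    only moments of \<open>\<mu>\<close>.\<close>
  have int: "quad_form Q1 (stack x (2 *\<^sub>R (A *v x) + k)) + (x, 2 *\<^sub>R (A *v x) + k) \<bullet> (c1, c2)
      = x \<bullet> (N *v x) + w \<bullet> x + (k \<bullet> (block22 Q1 *v k) + k \<bullet> c2)" for x
  proof -
    have Ax: "x \<bullet> (A *v y) = (A *v x) \<bullet> y" "(A *v y) \<bullet> x = y \<bullet> (A *v x)" for y
      using symmetric_matrix_inner_commute[OF A, of x y] by (simp_all add: inner_commute)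
    have "(A *v x) \<bullet> (block21 Q1 *v x) = x \<bullet> (block12 Q1 *v (A *v x))"
      by (simp add: symmetric_blocks(3)[OF Q1] inner_commute[of "A *v x"] dot_lmul_matrix)
    moreover have "k \<bullet> (block22 Q1 *v (A *v x)) = (A *v x) \<bullet> (block22 Q1 *v k)"
      by (rule symmetric_matrix_inner_commute[OF symmetric_blocks(2)[OF Q1]])
    ultimately show ?thesis
      unfolding quad_form_stack[OF Q1] N_def w_def
      by (simp add: matrix_vector_bilinear_simps inner_add_left inner_add_right Ax
          inner_commute[of _ x] matrix_vector_mul_assoc[symmetric] algebra_simps)
  qed
  have "(\<integral>z. quad_form Q1 (stack (fst z) (snd z)) + z \<bullet> (c1, c2) \<partial>distr \<mu> borel (\<lambda>x. (x, 2 *\<^sub>R (A *v x) + k)))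
      = (\<integral>x. (x \<bullet> (N *v x) + w \<bullet> x) + (k \<bullet> (block22 Q1 *v k) + k \<bullet> c2) \<partial>\<mu>)"
    by (subst integral_distr[OF mA mf]) (simp only: fst_conv snd_conv int)
  also have "\<dots> = N \<bullet> second_moment \<mu> + w \<bullet> m + (k \<bullet> (block22 Q1 *v k) + k \<bullet> c2)"
    using integral_quadratic[OF \<mu>, of N w] unfolding m_def
    by (subst Bochner_Integration.integral_add) (simp_all add: prob_space)
  finally have 1: "(\<integral>z. quad_form Q1 (stack (fst z) (snd z)) + z \<bullet> (c1, c2) \<partial>distr \<mu> borel (\<lambda>x. (x, 2 *\<^sub>R (A *v x) + k)))
      = N \<bullet> second_moment \<mu> + w \<bullet> m + (k \<bullet> (block22 Q1 *v k) + k \<bullet> c2)" .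
  have 2: "(\<integral>z. fst z \<partial>distr \<mu> borel (\<lambda>x. (x, 2 *\<^sub>R (A *v x) + k))) = m"
    by (subst integral_distr[OF mA])
      (auto simp: m_def mean_def intro!: borel_measurable_continuous_onI continuous_intros)
  have iA: "integrable \<mu> (\<lambda>x. A *v x)" "(\<integral>x. A *v x \<partial>\<mu>) = A *v m"
    using integrable_bounded_linear[OF matrix_vector_mul_bounded_linear P2_integrable(1)[OF \<mu>]]
      integral_bounded_linear[OF matrix_vector_mul_bounded_linear P2_integrable(1)[OF \<mu>]]
    by (simp_all add: m_def mean_def)
  have 3: "(\<integral>z. snd z \<partial>distr \<mu> borel (\<lambda>x. (x, 2 *\<^sub>R (A *v x) + k))) = 2 *\<^sub>R (A *v m) + k"
    using iA by (subst integral_distr[OF mA])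
      (auto simp: prob_space intro!: borel_measurable_continuous_onI continuous_intros)
  show ?thesis
    unfolding quad_H_def 1 2 3 quad_form_stack[OF Q2] by (simp add: N_def w_def)
qed

subsection \<open>The HJBI equation\<close>

lemma block_add:
  "block11 (Q + Q') = block11 Q + block11 Q'" "block12 (Q + Q') = block12 Q + block12 Q'"
  "block21 (Q + Q') = block21 Q + block21 Q'" "block22 (Q + Q') = block22 Q + block22 Q'"
  by (simp_all add: block11_def block12_def block21_def block22_def vec_eq_iff)

text \<open>
  The linear part is \<open>p - 2 S x\<close> along one trajectory \<open>(x, p)\<close> of the affine Hamiltonian system.
\<close>
lemma riccati_linear_part_exists:
  fixes Q :: "real ^ ('i::finite + 'i) ^ ('i + 'i)" and S :: "real \<Rightarrow> real ^ 'i ^ 'i"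
  assumes S: "\<And>t. t \<in> I \<Longrightarrow> (S has_vector_derivative - (block11 Q + 4 *\<^sub>R (S t ** block22 Q ** S t)
       + 2 *\<^sub>R (S t ** block21 Q) + 2 *\<^sub>R (block12 Q ** S t))) (at t within I)"
  shows "\<exists>b. b T = cT \<and> (\<forall>t\<in>I. (b has_vector_derivative - (2 *\<^sub>R (block12 Q *v b t)
       + 4 *\<^sub>R ((S t ** block22 Q) *v b t) + c1 + 2 *\<^sub>R (S t *v c2))) (at t within I))"
proof -
  \<comment> \<open>The extra real coordinate has zero velocity and starts at 1. It carries the
    inhomogeneous terms \<open>c1\<close> and \<open>c2\<close>, making the affine system
    linear.\<close>
  define L where "L = (\<lambda>z :: ((real ^ 'i) \<times> (real ^ 'i)) \<times> real.
    ((2 *\<^sub>R (block21 Q *v fst (fst z) + block22 Q *v snd (fst z)) + snd z *\<^sub>R c2,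
      - (2 *\<^sub>R (block11 Q *v fst (fst z) + block12 Q *v snd (fst z))) - snd z *\<^sub>R c1), 0 :: real))"
  have "linear L" unfolding L_def
    by (rule linearI) (simp_all add: matrix_vector_bilinear_simps algebra_simps)
  \<comment> \<open>Since the state is zero at \<open>T\<close>, the terminal value
    \<open>b T = cT\<close> holds whatever \<open>S T\<close> is.\<close>
  from linear_ode_exists[OF this, of T "((0, cT), 1)"] obtain Z
    where ZT: "Z T = ((0, cT), 1)" and Z: "\<And>t. (Z has_vector_derivative L (Z t)) (at t)" by blast
  define x p s where "x t = fst (fst (Z t))" and "p t = snd (fst (Z t))" and "s t = snd (Z t)" for t
  have ds: "(s has_vector_derivative 0) (at t)" for t
    using bounded_linear.has_vector_derivative[OF bounded_linear_snd Z, of t] by (simp add: s_def[abs_def] L_def)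
  have s: "s t = 1" for t
  proof -
    have "s t = s T"
      using has_vector_derivative_zero_constant[of UNIV s] ds by (metis convex_UNIV iso_tuple_UNIV_I)
    then show ?thesis by (simp add: s_def ZT)
  qed
  have x: "(x has_vector_derivative 2 *\<^sub>R (block21 Q *v x t + block22 Q *v p t) + c2) (at t)" for t
    using bounded_linear.has_vector_derivative[OF bounded_linear_compose[OF bounded_linear_fst bounded_linear_fst] Z, of t] s[of t]
    by (simp add: x_def[abs_def] p_def s_def L_def)
  have p: "(p has_vector_derivative - (2 *\<^sub>R (block11 Q *v x t + block12 Q *v p t)) - c1) (at t)" for t
    using bounded_linear.has_vector_derivative[OF bounded_linear_compose[OF bounded_linear_snd bounded_linear_fst] Z, of t] s[of t]
    by (simp add: x_def p_def[abs_def] s_def L_def)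
  define b where "b t = p t - 2 *\<^sub>R (S t *v x t)" for t
  have "(b has_vector_derivative - (2 *\<^sub>R (block12 Q *v b t)
       + 4 *\<^sub>R ((S t ** block22 Q) *v b t) + c1 + 2 *\<^sub>R (S t *v c2))) (at t within I)" if "t \<in> I" for t
  proof -
    have "(b has_vector_derivative (- (2 *\<^sub>R (block11 Q *v x t + block12 Q *v p t)) - c1)
      - 2 *\<^sub>R (S t *v (2 *\<^sub>R (block21 Q *v x t + block22 Q *v p t) + c2)
        + (- (block11 Q + 4 *\<^sub>R (S t ** block22 Q ** S t)
          + 2 *\<^sub>R (S t ** block21 Q) + 2 *\<^sub>R (block12 Q ** S t))) *v x t)) (at t within I)"
      unfolding b_def
      by (intro has_vector_derivative_diff has_vector_derivative_at_within[OF p]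
          bounded_linear.has_vector_derivative[OF bounded_linear_scaleR_right]
          bounded_bilinear.has_vector_derivative[OF bounded_bilinear_matrix_vector_mult S[OF that]]
          has_vector_derivative_at_within[OF x])
    \<comment> \<open>After this substitution all terms containing \<open>x t\<close> cancel by the
      Riccati equation for \<open>S\<close>.\<close>
    moreover have pt: "p t = b t + 2 *\<^sub>R (S t *v x t)" by (simp add: b_def)
    ultimately show ?thesis
      unfolding pt by (simp add: matrix_vector_bilinear_simps matrix_vector_mul_assoc matrix_mul_assoc algebra_simps)
  qed
  moreover have "b T = cT" by (simp add: b_def p_def x_def ZT)
  ultimately show ?thesis by blast
qed

text \<open>Verification by coefficients: \<open>r1\<close> belongs to the second moment,
  \<open>r2\<close> to the mean, \<open>r3\<close> to the product of the mean with itself and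
  \<open>r4\<close> to the constant. The transposes are dropped here, which the symmetry assumptions
  justify.\<close>

lemma hjbi_solution_quad_functional:
  fixes Q1 Q2 :: "real ^ ('i::finite + 'i) ^ ('i + 'i)"
    and \<sigma> :: "real ^ 'i ^ 'i" and c1 c2 :: "real ^ 'i"
    and a1 a3 :: "real \<Rightarrow> real ^ 'i ^ 'i" and a2 :: "real \<Rightarrow> real ^ 'i" and a4 :: "real \<Rightarrow> real"
  defines "r1 \<equiv> \<lambda>t. block11 Q1 + 4 *\<^sub>R (a1 t ** block22 Q1 ** a1 t)
      + 2 *\<^sub>R (a1 t ** block21 Q1) + 2 *\<^sub>R (block12 Q1 ** a1 t)"
    and "r2 \<equiv> \<lambda>t. 2 *\<^sub>R (block12 Q1 *v a2 t) + 4 *\<^sub>R ((a1 t ** block22 Q1) *v a2 t)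
      + 4 *\<^sub>R ((a3 t ** block22 Q1) *v a2 t) + 2 *\<^sub>R (block12 Q2 *v a2 t)
      + 4 *\<^sub>R (((a1 t + a3 t) ** block22 Q2) *v a2 t) + c1 + 2 *\<^sub>R ((a1 t + a3 t) *v c2)"
    and "r3 \<equiv> \<lambda>t. 2 *\<^sub>R (block12 Q1 ** a3 t) + 2 *\<^sub>R (a3 t ** block21 Q1)
      + 4 *\<^sub>R (a1 t ** block22 Q1 ** a3 t) + 4 *\<^sub>R (a3 t ** block22 Q1 ** a3 t)
      + 4 *\<^sub>R (a3 t ** block22 Q1 ** a1 t) + block11 Q2
      + 2 *\<^sub>R (block12 Q2 ** (a1 t + a3 t)) + 2 *\<^sub>R ((a1 t + a3 t) ** block21 Q2)
      + 4 *\<^sub>R ((a1 t + a3 t) ** block22 Q2 ** (a1 t + a3 t))"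
    and "r4 \<equiv> \<lambda>t. a2 t \<bullet> (block22 Q1 *v a2 t) + a2 t \<bullet> (block22 Q2 *v a2 t) + a2 t \<bullet> c2
      + trace (transpose \<sigma> ** \<sigma> ** a1 t)"
  assumes Q1: "transpose Q1 = Q1" and Q2: "transpose Q2 = Q2"
    and s1: "\<And>t. t \<in> {0..T} \<Longrightarrow> transpose (a1 t) = a1 t"
    and s3: "\<And>t. t \<in> {0..T} \<Longrightarrow> transpose (a3 t) = a3 t"
    and d1: "\<And>t. t \<in> {0..T} \<Longrightarrow> (a1 has_vector_derivative - r1 t) (at t within {0..T})"
    and d2: "\<And>t. t \<in> {0..T} \<Longrightarrow> (a2 has_vector_derivative - r2 t) (at t within {0..T})"
    and d3: "\<And>t. t \<in> {0..T} \<Longrightarrow> (a3 has_vector_derivative - r3 t) (at t within {0..T})"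
    and d4: "\<And>t. t \<in> {0..T} \<Longrightarrow> (a4 has_vector_derivative - r4 t) (at t within {0..T})"
    and T: "a4 T = 0"
  shows "HJBI_solution T \<sigma> (quad_H Q1 Q2 (c1, c2)) (quad_U (a1 T) (a3 T) (a2 T))
    (\<lambda>t. quad_functional (a1 t) (a2 t) (a3 t) (a4 t))"
proof -
  have cont: "continuous_on {0..T} f" if "\<And>t. t \<in> {0..T} \<Longrightarrow> (f has_vector_derivative f' t) (at t within {0..T})"
    for f' and f :: "real \<Rightarrow> 'z::real_normed_vector"
    using that by (meson continuous_on_eq_continuous_within has_vector_derivative_continuous)
  have ca: "continuous_on {0..T} a1" "continuous_on {0..T} a2" "continuous_on {0..T} a3" "continuous_on {0..T} a4"
    by (rule cont, erule d1 d2 d3 d4)+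
  have sub: "{0..<T} \<subseteq> {0..T}" by auto
  note ca' = ca[THEN continuous_on_subset, OF sub]
  note cmm = bounded_bilinear.continuous_on[OF bounded_bilinear_matrix_matrix_mult]
    bounded_bilinear.continuous_on[OF bounded_bilinear_matrix_vector_mult]
  have ctr: "continuous_on UNIV (trace :: real ^ 'i ^ 'i \<Rightarrow> real)"
    unfolding trace_def by (intro continuous_intros)
  have cr: "continuous_on {0..<T} (\<lambda>t. - r1 t)" "continuous_on {0..<T} (\<lambda>t. - r2 t)"
    "continuous_on {0..<T} (\<lambda>t. - r3 t)" "continuous_on {0..<T} (\<lambda>t. - r4 t)"
    unfolding r1_def r2_def r3_def r4_def
    by (intro continuous_intros cmm ca' continuous_on_compose2[OF ctr]; simp)+
  define DV where "DV t \<mu> x = 2 *\<^sub>R (a1 t *v x) + a2 t + 2 *\<^sub>R (a3 t *v mean \<mu>)" for t \<mu> x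
  have trace2: "trace (transpose \<sigma> ** \<sigma> ** (2 *\<^sub>R M)) = 2 * trace (transpose \<sigma> ** \<sigma> ** M)" for M
    by (simp add: matrix_bilinear_simps trace_def sum_distrib_left)
  show ?thesis
    unfolding HJBI_solution_def
  proof (intro conjI ballI exI allI)
    show "jointly_continuous {0..T} (\<lambda>t \<mu> x. quad_functional (a1 t) (a2 t) (a3 t) (a4 t) \<mu>)"
      by (rule jointly_continuous_quad_functional[OF ca])
    show "quad_functional (a1 T) (a2 T) (a3 T) (a4 T) \<mu> = quad_U (a1 T) (a3 T) (a2 T) \<mu>"
      if "\<mu> \<in> P2" for \<mu> using that by (simp add: quad_U_eq_quad_functional T)
    show "jointly_continuous {0..<T} (\<lambda>t \<mu> x. quad_functional (- r1 t) (- r2 t) (- r3 t) (- r4 t) \<mu>)"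
      by (rule jointly_continuous_quad_functional[OF cr])
    show "jointly_continuous {0..<T} DV"
      unfolding DV_def[abs_def] by (rule jointly_continuous_quad_functional_derivative(1)[OF ca'(1-3)])
    \<comment> \<open>The spatial Jacobian is the constant matrix \<open>2 a1\<close>; its 2 cancels
      the 1/2 in front of the trace integral and leaves the trace term of \<open>r4\<close>.\<close>
    show "jointly_continuous {0..<T} (\<lambda>t \<mu> (x :: real ^ 'i). 2 *\<^sub>R a1 t)"
      by (rule jointly_continuous_quad_functional_derivative(2)[OF ca'(1-3)])
    fix t and \<mu> :: "(real ^ 'i) measure" assume t: "t \<in> {0..<T}" and \<mu>: "\<mu> \<in> P2"
    then have t': "t \<in> {0..T}" by simp
    interpret prob_space \<mu> using \<mu> by (rule P2_prob_space)
    show "((\<lambda>s. quad_functional (a1 s) (a2 s) (a3 s) (a4 s) \<mu>) has_real_derivative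
        quad_functional (- r1 t) (- r2 t) (- r3 t) (- r4 t) \<mu>) (at t within {0..T})"
      unfolding has_real_derivative_iff_has_vector_derivative quad_functional_def
      by (intro has_vector_derivative_add d4[OF t']
          bounded_linear.has_vector_derivative[OF bounded_linear_inner_left d1[OF t']]
          bounded_linear.has_vector_derivative[OF bounded_linear_inner_left d2[OF t']]
          bounded_linear.has_vector_derivative[OF bounded_linear_inner_right]
          bounded_linear.has_vector_derivative[OF
            bounded_bilinear.bounded_linear_left[OF bounded_bilinear_matrix_vector_mult] d3[OF t']])
    show "has_wasserstein_derivative (quad_functional (a1 t) (a2 t) (a3 t) (a4 t)) (DV t \<mu>) \<mu>"
      unfolding DV_def[abs_def] by (rule has_wasserstein_derivative_quad_functional[OF s1[OF t'] s3[OF t'] \<mu>])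
    show "(DV t \<mu> has_derivative (\<lambda>h. (2 *\<^sub>R a1 t) *v h)) (at x)" for x
    proof -
      have "bounded_linear (\<lambda>x. (2 *\<^sub>R a1 t) *v x)" by (rule matrix_vector_mul_bounded_linear)
      then have "((\<lambda>x. (2 *\<^sub>R a1 t) *v x + (a2 t + 2 *\<^sub>R (a3 t *v mean \<mu>))) has_derivative
          (\<lambda>h. (2 *\<^sub>R a1 t) *v h)) (at x)"
        by (intro has_derivative_add_const bounded_linear_imp_has_derivative)
      then show ?thesis
        by (simp add: DV_def[abs_def] matrix_vector_bilinear_simps add.assoc)
    qed
    show "integrable \<mu> (\<lambda>x. trace (transpose \<sigma> ** \<sigma> ** (2 *\<^sub>R a1 t)))" by simp
    define A D b m where "A = a1 t" "D = a3 t" "b = a2 t" "m = mean \<mu>"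
    have sA: "transpose A = A" and sD: "transpose D = D" using s1 s3 t' by (simp_all add: A_D_b_m_def)
    have DV: "DV t \<mu> = (\<lambda>x. 2 *\<^sub>R (A *v x) + (b + 2 *\<^sub>R (D *v m)))"
      by (simp add: DV_def[abs_def] A_D_b_m_def add.assoc)
    note sb1 = symmetric_blocks[OF Q1] and sb2 = symmetric_blocks[OF Q2]
    have mv: "m \<bullet> (A *v y) = (A *v m) \<bullet> y" "(A *v y) \<bullet> m = y \<bullet> (A *v m)"
      "m \<bullet> (D *v y) = (D *v m) \<bullet> y" "(D *v y) \<bullet> m = y \<bullet> (D *v m)" for y
      using symmetric_matrix_inner_commute[OF sA, of m y] symmetric_matrix_inner_commute[OF sD, of m y]
      by (simp_all add: inner_commute)
    have b21: "u \<bullet> (block21 Q1 *v v) = v \<bullet> (block12 Q1 *v u)"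
      "u \<bullet> (block21 Q2 *v v) = v \<bullet> (block12 Q2 *v u)" for u v
      by (simp_all add: sb1(3) sb2(3) inner_commute[of u] dot_lmul_matrix)
    note sw = symmetric_matrix_inner_commute[OF sb1(2)] symmetric_matrix_inner_commute[OF sb2(2)]
    show "quad_functional (- r1 t) (- r2 t) (- r3 t) (- r4 t) \<mu>
        + 1 / 2 * (\<integral>x. trace (transpose \<sigma> ** \<sigma> ** (2 *\<^sub>R a1 t)) \<partial>\<mu>)
        + quad_H Q1 Q2 (c1, c2) (distr \<mu> borel (\<lambda>x. (x, DV t \<mu> x))) = 0"
      unfolding DV quad_H_quad_functional[OF sA Q1 Q2 \<mu>] quad_functional_def r1_def r2_def r3_def r4_def
        A_D_b_m_def[symmetric]
      \<comment> \<open>Mixed products of \<open>b\<close>, \<open>A *v m\<close> and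
        \<open>D *v m\<close> through \<open>block22\<close> occur in both orders; these instances
        of symmetry identify them, so that the remaining comparison is linear.\<close>
      using sw(1)[of b "A *v m"] sw(1)[of b "D *v m"] sw(1)[of "D *v m" "A *v m"]
        sw(2)[of b "A *v m"] sw(2)[of b "D *v m"] sw(2)[of "D *v m" "A *v m"]
      by (simp add: prob_space trace2 matrix_vector_bilinear_simps inner_add_left inner_add_right
          matrix_vector_mul_assoc[symmetric] mv b21 inner_commute[of _ m] algebra_simps)
  qed
qed

theorem theorem2p8:
  fixes T C :: real
    and \<sigma> QT1 QT2 :: "real ^ ('m::finite + 'n::finite) ^ ('m + 'n)"
    and Q1 Q2 :: "real ^ (('m + 'n) + ('m + 'n)) ^ (('m + 'n) + ('m + 'n))"
    and c1 c2 cT :: "real ^ ('m + 'n)"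
  assumes "T > 0"
    and "transpose Q1 = Q1" and "transpose Q2 = Q2"
    and "transpose QT1 = QT1" and "transpose QT2 = QT2"
    and "running_bound C Q1" and "running_bound C (Q1 + Q2)"
    and "terminal_bound C QT1" and "terminal_bound C (QT1 + QT2)"
  shows "\<exists>(V :: real \<Rightarrow> (real ^ ('m + 'n)) measure \<Rightarrow> real)
      (a1 :: real \<Rightarrow> real ^ ('m + 'n) ^ ('m + 'n)) (a2 :: real \<Rightarrow> real ^ ('m + 'n))
      (a3 :: real \<Rightarrow> real ^ ('m + 'n) ^ ('m + 'n)) (a4 :: real \<Rightarrow> real).
    HJBI_solution T \<sigma> (quad_H Q1 Q2 (c1, c2)) (quad_U QT1 QT2 cT) V \<and>
    (\<forall>t\<in>{0..T}. \<forall>\<mu>\<in>P2.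
      V t \<mu> = (\<integral>x. x \<bullet> (a1 t *v x) + a2 t \<bullet> x \<partial>\<mu>)
            + (\<integral>x. (\<integral>y. x \<bullet> (a3 t *v y) \<partial>\<mu>) \<partial>\<mu>) + a4 t) \<and>
    (\<forall>t\<in>{0..T}.
      (a1 has_vector_derivative
        - (block11 Q1
           + 4 *\<^sub>R (transpose (a1 t) ** block22 Q1 ** a1 t)
           + 2 *\<^sub>R (transpose (a1 t) ** block21 Q1)
           + 2 *\<^sub>R (block12 Q1 ** a1 t)))
        (at t within {0..T}) \<and>
      (a2 has_vector_derivative
        - (2 *\<^sub>R (block12 Q1 *v a2 t)
           + 4 *\<^sub>R ((a1 t ** block22 Q1) *v a2 t)
           + 4 *\<^sub>R ((a3 t ** block22 Q1) *v a2 t)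
           + 2 *\<^sub>R (block12 Q2 *v a2 t)
           + 4 *\<^sub>R (((a1 t + a3 t) ** block22 Q2) *v a2 t)
           + c1 + 2 *\<^sub>R ((a1 t + a3 t) *v c2)))
        (at t within {0..T}) \<and>
      (a3 has_vector_derivative
        - (2 *\<^sub>R (block12 Q1 ** a3 t)
           + 2 *\<^sub>R (transpose (a3 t) ** block21 Q1)
           + 4 *\<^sub>R (transpose (a1 t) ** block22 Q1 ** a3 t)
           + 4 *\<^sub>R (transpose (a3 t) ** block22 Q1 ** a3 t)
           + 4 *\<^sub>R (transpose (a3 t) ** block22 Q1 ** a1 t)
           + block11 Q2
           + 2 *\<^sub>R (block12 Q2 ** (a1 t + a3 t))
           + 2 *\<^sub>R (transpose (a1 t + a3 t) ** block21 Q2)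
           + 4 *\<^sub>R (transpose (a1 t + a3 t) ** block22 Q2 ** (a1 t + a3 t))))
        (at t within {0..T}) \<and>
      (a4 has_real_derivative
        - (a2 t \<bullet> (block22 Q1 *v a2 t)
           + a2 t \<bullet> (block22 Q2 *v a2 t)
           + a2 t \<bullet> c2
           + trace (transpose \<sigma> ** \<sigma> ** a1 t)))
        (at t within {0..T})) \<and>
    a1 T = QT1 \<and> a2 T = cT \<and> a3 T = QT2 \<and> a4 T = 0"
proof -
  note Q1 = assms(2) and Q2 = assms(3)
  have QS: "transpose (Q1 + Q2) = Q1 + Q2" and QTS: "transpose (QT1 + QT2) = QT1 + QT2"
    using assms(2-5) by (simp_all add: transpose_linear_simps)
  obtain a1 where a1T: "a1 T = QT1" and a1: "\<And>t. t \<in> {0..T} \<Longrightarrow> transpose (a1 t) = a1 t"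
    "\<And>t. t \<in> {0..T} \<Longrightarrow> (a1 has_vector_derivative - (block11 Q1 + 4 *\<^sub>R (a1 t ** block22 Q1 ** a1 t)
       + 2 *\<^sub>R (a1 t ** block21 Q1) + 2 *\<^sub>R (block12 Q1 ** a1 t))) (at t within {0..T})"
    using riccati_exists[OF Q1 assms(6,8,4), of T 0] by blast
  obtain S where ST: "S T = QT1 + QT2" and S: "\<And>t. t \<in> {0..T} \<Longrightarrow> transpose (S t) = S t"
    "\<And>t. t \<in> {0..T} \<Longrightarrow> (S has_vector_derivative - (block11 (Q1 + Q2) + 4 *\<^sub>R (S t ** block22 (Q1 + Q2) ** S t)
       + 2 *\<^sub>R (S t ** block21 (Q1 + Q2)) + 2 *\<^sub>R (block12 (Q1 + Q2) ** S t))) (at t within {0..T})"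
    using riccati_exists[OF QS assms(7,9) QTS, of T 0] by blast
  \<comment> \<open>With \<open>a1 + a3\<close> written as \<open>S\<close>, the \<open>Q1\<close>
    and \<open>Q2\<close> terms of the equation for \<open>a2\<close> combine into the linear
    equation with data \<open>Q1 + Q2\<close>.\<close>
  obtain a2 where a2T: "a2 T = cT" and a2: "\<And>t. t \<in> {0..T} \<Longrightarrow>
      (a2 has_vector_derivative - (2 *\<^sub>R (block12 (Q1 + Q2) *v a2 t)
       + 4 *\<^sub>R ((S t ** block22 (Q1 + Q2)) *v a2 t) + c1 + 2 *\<^sub>R (S t *v c2))) (at t within {0..T})"
    using riccati_linear_part_exists[OF S(2), of T cT c1 c2] by blast
  define a3 where "a3 t = S t - a1 t" for t
  have S_eq: "S t = a1 t + a3 t" for t by (simp add: a3_def)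
  have s3: "transpose (a3 t) = a3 t" if "t \<in> {0..T}" for t
    using a1(1)[OF that] S(1)[OF that] by (simp add: a3_def transpose_linear_simps)
  define r4 where "r4 t = a2 t \<bullet> (block22 Q1 *v a2 t) + a2 t \<bullet> (block22 Q2 *v a2 t) + a2 t \<bullet> c2
      + trace (transpose \<sigma> ** \<sigma> ** a1 t)" for t
  have cont: "continuous_on {0..T} a1" "continuous_on {0..T} a2"
    using a1(2) a2 by (meson continuous_on_eq_continuous_within has_vector_derivative_continuous)+
  have "continuous_on {0..T} (\<lambda>t. - r4 t)"
    unfolding r4_def trace_def
    by (intro continuous_intros cont bounded_bilinear.continuous_on[OF bounded_bilinear_matrix_matrix_mult]
        bounded_bilinear.continuous_on[OF bounded_bilinear_matrix_vector_mult])
  from antiderivative_continuous[OF this] obtain g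
    where g: "\<And>t. t \<in> {0..T} \<Longrightarrow> (g has_vector_derivative - r4 t) (at t within {0..T})" by blast
  \<comment> \<open>Subtracting the value at \<open>T\<close> normalizes the antiderivative to the
    terminal condition.\<close>
  define a4 where "a4 t = g t - g T" for t
  have d4: "(a4 has_vector_derivative - r4 t) (at t within {0..T})" if "t \<in> {0..T}" for t
    unfolding a4_def using has_vector_derivative_diff[OF g[OF that] has_vector_derivative_const[of "g T"]] by simp
  have d2: "(a2 has_vector_derivative - (2 *\<^sub>R (block12 Q1 *v a2 t) + 4 *\<^sub>R ((a1 t ** block22 Q1) *v a2 t)
      + 4 *\<^sub>R ((a3 t ** block22 Q1) *v a2 t) + 2 *\<^sub>R (block12 Q2 *v a2 t)
      + 4 *\<^sub>R (((a1 t + a3 t) ** block22 Q2) *v a2 t) + c1 + 2 *\<^sub>R ((a1 t + a3 t) *v c2))) (at t within {0..T})"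
    if "t \<in> {0..T}" for t
    using a2[OF that] unfolding S_eq block_add
    by (simp add: matrix_bilinear_simps matrix_vector_bilinear_simps algebra_simps)
  have d3: "(a3 has_vector_derivative - (2 *\<^sub>R (block12 Q1 ** a3 t) + 2 *\<^sub>R (a3 t ** block21 Q1)
      + 4 *\<^sub>R (a1 t ** block22 Q1 ** a3 t) + 4 *\<^sub>R (a3 t ** block22 Q1 ** a3 t)
      + 4 *\<^sub>R (a3 t ** block22 Q1 ** a1 t) + block11 Q2
      + 2 *\<^sub>R (block12 Q2 ** (a1 t + a3 t)) + 2 *\<^sub>R ((a1 t + a3 t) ** block21 Q2)
      + 4 *\<^sub>R ((a1 t + a3 t) ** block22 Q2 ** (a1 t + a3 t)))) (at t within {0..T})"
    if "t \<in> {0..T}" for t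
    \<comment> \<open>Subtract the two Riccati equations and expand \<open>S\<close> as
      \<open>a1 + a3\<close>: the pure \<open>a1\<close> terms with data \<open>Q1\<close> drop
      out.\<close>
    unfolding a3_def[abs_def]
    by (rule has_vector_derivative_eq_rhs[OF has_vector_derivative_diff[OF S(2)[OF that] a1(2)[OF that]]])
      (simp add: block_add a3_def matrix_bilinear_simps algebra_simps)
  define V where "V t = quad_functional (a1 t) (a2 t) (a3 t) (a4 t)" for t
  have a3T: "a3 T = QT2" by (simp add: a3_def a1T ST)
  have a4T: "a4 T = 0" by (simp add: a4_def)
  have V: "HJBI_solution T \<sigma> (quad_H Q1 Q2 (c1, c2)) (quad_U QT1 QT2 cT) V"
    using hjbi_solution_quad_functional[OF Q1 Q2 a1(1) s3 a1(2) d2 d3 d4[unfolded r4_def] a4T]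
    by (simp only: a1T a2T a3T V_def[abs_def])
  show ?thesis
  proof (intro exI conjI ballI)
    show "V t \<mu> = (\<integral>x. x \<bullet> (a1 t *v x) + a2 t \<bullet> x \<partial>\<mu>)
            + (\<integral>x. (\<integral>y. x \<bullet> (a3 t *v y) \<partial>\<mu>) \<partial>\<mu>) + a4 t" if "\<mu> \<in> P2" for t \<mu>
      unfolding V_def by (rule quad_functional_eq_integral[OF that])
  \<comment> \<open>The transposes in the stated equations disappear by symmetry of
    \<open>a1\<close> and \<open>a3\<close> on the interval.\<close>
  qed (use V a1T a2T a3T a4T a1 d2 d3 d4 s3 in
      \<open>simp_all only: has_real_derivative_iff_has_vector_derivative r4_def transpose_linear_simps\<close>)
qed

end
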